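(* Let $F(t,r)$ be a function of smooth variation of index $d\in(0,1)$ at the diagonal, i.e. $F\in SR_d^2(0+)$, let $\{X(t)\}_{t\ge 0}$ be a semimartingale with $X(0)=0$ $P$-a.s., and define $$M(t)=\int_0^t F(t,r)\,dX(r),\qquad t\ge 0 .$$ Then $$\lim_{h\downarrow 0}\ \sup_{0<s<t<1,\ |t-s|\le h}\frac{|M(t)-M(s)|}{F(t,s)}=\sup_{s\in[0,1]}|\Delta_X(s)|,\qquad P\text{-a.s.},$$ where $\Delta_X(s)=X(s)-X(s-)$.
   Context: Notation: $f^{(n,m)}(s,r)=\partial^{n+m}f(s,r)/\partial s^n\partial r^m$. Let $E=\{(s,r):-\infty<r\le s<\infty\}$ and $\tilde E=\{(s,r):-\infty<r<s<\infty\}$. $\mathbb{C}_+^{(k)}(E)$ is the space of functions $f:E\to\mathbb{R}$ that are continuous on $E$, have continuous partial derivatives of order $k$ on $\tilde E$, and are strictly positive on $\tilde E$. Functions of smooth variation: for $\rho>0$, $f\in SR_\rho^2(0+)$ (smooth variation of index $\rho$ at the diagonal) means that $f\in\mathbb{C}_+^{(2)}(E)$ and, for every compact set $K\subset\mathbb{R}$: (a) $\lim_{h\downarrow0}\sup_{t\in K}\big|\frac{h f^{(0,1)}(t,t-h)}{f(t,t-h)}+\rho\big|=0$; (b) $\lim_{h\downarrow0}\sup_{t\in K}\big|\frac{h f^{(1,0)}(t+h,t)}{f(t+h,t)}-\rho\big|=0$; (c) $\lim_{h\downarrow0}\sup_{t\in K}\big|\frac{h^2 f^{(1,1)}(t,t-h)}{f(t,t-h)}+\rho(\rho-1)\big|=0$;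 (d) $\lim_{h\downarrow0}\sup_{t\in K}\big|\frac{h^2 f^{(0,2)}(t,t-h)}{f(t,t-h)}-\rho(\rho-1)\big|=0$. The kernel $F$ is deterministic and real-valued. Semimartingales have càdlàg paths, and by convention $X(0-)=0$ $P$-a.s.
   Formalization: M is taken in its version with a.s. right-continuous paths; the limit is shown to be the supremum of |Δ_X(s)| over s in [0,1), and over s in [0,1] when Δ_X(1)=0, because the printed formula fails for X=1_{[1,∞)}, which jumps at time 1. *)

theory Defs
  imports "HOL-Probability.Probability"
begin

text \<open>Processes are functions \<^typ>\<open>real \<Rightarrow> 'a \<Rightarrow> real\<close> and filtrations are functions
  \<^typ>\<open>real \<Rightarrow> 'a measure\<close>; only times \<^prop>\<open>(t::real) \<ge> 0\<close> matter. A filtration indexed by the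
  nonnegative reals is viewed as one indexed by all reals by keeping it constant on the negative
  axis. Path properties are required almost surely. The usual conditions are not imposed.\<close>


section \<open>Kernels of smooth variation at the diagonal\<close>

definition E_closed :: "(real \<times> real) set" where
  "E_closed = {(s, r). r \<le> s}"

definition E_open :: "(real \<times> real) set" where
  "E_open = {(s, r). r < s}"

definition d_fst :: "(real \<Rightarrow> real \<Rightarrow> real) \<Rightarrow> real \<Rightarrow> real \<Rightarrow> real" where
  "d_fst f s r = deriv (\<lambda>x. f x r) s"

definition d_snd :: "(real \<Rightarrow> real \<Rightarrow> real) \<Rightarrow> real \<Rightarrow> real \<Rightarrow> real" where
  "d_snd f s r = deriv (\<lambda>y. f s y) r"

definition partial :: "nat \<Rightarrow> nat \<Rightarrow> (real \<Rightarrow> real \<Rightarrow> real) \<Rightarrow> real \<Rightarrow> real \<Rightarrow> real" where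
  "partial n m f = (d_fst ^^ n) ((d_snd ^^ m) f)"

text \<open>\<open>cont_partials k f\<close>: all iterated partial derivatives of \<open>f\<close> of order \<open>k\<close> (in any order of
  differentiation) exist and are continuous on the open half plane. Since that set is open,
  the values of \<open>f\<close> below the diagonal are irrelevant.\<close>

primrec cont_partials :: "nat \<Rightarrow> (real \<Rightarrow> real \<Rightarrow> real) \<Rightarrow> bool" where
  "cont_partials 0 f \<longleftrightarrow> continuous_on E_open (\<lambda>(s, r). f s r)"
| "cont_partials (Suc k) f \<longleftrightarrow>
     (\<forall>(s, r)\<in>E_open. (\<lambda>x. f x r) differentiable (at s) \<and> (\<lambda>y. f s y) differentiable (at r)) \<and>
     cont_partials k (d_fst f) \<and> cont_partials k (d_snd f)"

definition C_plus :: "nat \<Rightarrow> (real \<Rightarrow> real \<Rightarrow> real) \<Rightarrow> bool" where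
  "C_plus k f \<longleftrightarrow>
     continuous_on E_closed (\<lambda>(s, r). f s r) \<and> cont_partials k f \<and> (\<forall>(s, r)\<in>E_open. 0 < f s r)"

text \<open>The suprema are taken in \<^typ>\<open>ennreal\<close>, so that they are meaningful without an a priori bound.\<close>

definition smooth_variation :: "real \<Rightarrow> (real \<Rightarrow> real \<Rightarrow> real) \<Rightarrow> bool" where
  "smooth_variation \<rho> f \<longleftrightarrow> C_plus 2 f \<and>
     (\<forall>K. compact K \<longrightarrow>
       ((\<lambda>h. SUP t\<in>K. ennreal \<bar>h * partial 0 1 f t (t - h) / f t (t - h) + \<rho>\<bar>) \<longlongrightarrow> 0) (at_right 0) \<and>
       ((\<lambda>h. SUP t\<in>K. ennreal \<bar>h * partial 1 0 f (t + h) t / f (t + h) t - \<rho>\<bar>) \<longlongrightarrow> 0) (at_right 0) \<and>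
       ((\<lambda>h. SUP t\<in>K. ennreal \<bar>h\<^sup>2 * partial 1 1 f t (t - h) / f t (t - h) + \<rho> * (\<rho> - 1)\<bar>) \<longlongrightarrow> 0)
         (at_right 0) \<and>
       ((\<lambda>h. SUP t\<in>K. ennreal \<bar>h\<^sup>2 * partial 0 2 f t (t - h) / f t (t - h) - \<rho> * (\<rho> - 1)\<bar>) \<longlongrightarrow> 0)
         (at_right 0))"


section \<open>Paths\<close>

definition cadlag :: "(real \<Rightarrow> real) \<Rightarrow> bool" where
  "cadlag x \<longleftrightarrow> (\<forall>t\<ge>0. (x \<longlongrightarrow> x t) (at_right t)) \<and> (\<forall>t>0. \<exists>l. (x \<longlongrightarrow> l) (at_left t))"

definition caglad :: "(real \<Rightarrow> real) \<Rightarrow> bool" where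
  "caglad x \<longleftrightarrow> (\<forall>t>0. (x \<longlongrightarrow> x t) (at_left t)) \<and> (\<forall>t\<ge>0. \<exists>l. (x \<longlongrightarrow> l) (at_right t))"

text \<open>\<open>jump x s\<close> is \<open>x(s) - x(s-)\<close>, with the convention \<open>x(0-) = 0\<close>.\<close>

definition jump :: "(real \<Rightarrow> real) \<Rightarrow> real \<Rightarrow> real" where
  "jump x s = x s - (if s = 0 then 0 else Lim (at_left s) x)"

definition finite_variation :: "(real \<Rightarrow> real) \<Rightarrow> bool" where
  "finite_variation x \<longleftrightarrow>
     (\<forall>t\<ge>0. \<exists>B. \<forall>(n::nat) p. mono p \<and> range p \<subseteq> {0..t} \<longrightarrow> (\<Sum>i<n. \<bar>x (p (Suc i)) - x (p i)\<bar>) \<le> B)"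


section \<open>Semimartingales\<close>

definition adapted :: "(real \<Rightarrow> 'a measure) \<Rightarrow> (real \<Rightarrow> 'a \<Rightarrow> real) \<Rightarrow> bool" where
  "adapted \<F> X \<longleftrightarrow> (\<forall>t\<ge>0. X t \<in> borel_measurable (\<F> t))"

definition martingale :: "'a measure \<Rightarrow> (real \<Rightarrow> 'a measure) \<Rightarrow> (real \<Rightarrow> 'a \<Rightarrow> real) \<Rightarrow> bool" where
  "martingale P \<F> X \<longleftrightarrow> adapted \<F> X \<and> (\<forall>t\<ge>0. integrable P (X t)) \<and>
     (\<forall>s t. 0 \<le> s \<and> s \<le> t \<longrightarrow> (AE \<omega> in P. real_cond_exp P (\<F> s) (X t) \<omega> = X s \<omega>))"

text \<open>The localizing stopping times are real valued, which is no restriction: \<open>T n\<close> may be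
  replaced by its minimum with \<open>n\<close>.\<close>

definition local_martingale :: "'a measure \<Rightarrow> (real \<Rightarrow> 'a measure) \<Rightarrow> (real \<Rightarrow> 'a \<Rightarrow> real) \<Rightarrow> bool" where
  "local_martingale P \<F> X \<longleftrightarrow> adapted \<F> X \<and> (AE \<omega> in P. cadlag (\<lambda>t. X t \<omega>)) \<and>
     (\<exists>T :: nat \<Rightarrow> 'a \<Rightarrow> real.
        (\<forall>n. stopping_time \<F> (T n)) \<and>
        (\<forall>n. \<forall>\<omega>\<in>space P. 0 \<le> T n \<omega> \<and> T n \<omega> \<le> T (Suc n) \<omega>) \<and>
        (AE \<omega> in P. filterlim (\<lambda>n. T n \<omega>) at_top sequentially) \<and>
        (\<forall>n. martingale P \<F> (\<lambda>t \<omega>. X (min t (T n \<omega>)) \<omega> - X 0 \<omega>)))"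

definition semimartingale :: "'a measure \<Rightarrow> (real \<Rightarrow> 'a measure) \<Rightarrow> (real \<Rightarrow> 'a \<Rightarrow> real) \<Rightarrow> bool" where
  "semimartingale P \<F> X \<longleftrightarrow> adapted \<F> X \<and> (AE \<omega> in P. cadlag (\<lambda>t. X t \<omega>)) \<and>
     (\<exists>N A. local_martingale P \<F> N \<and>
        adapted \<F> A \<and> (AE \<omega> in P. cadlag (\<lambda>t. A t \<omega>)) \<and> (AE \<omega> in P. finite_variation (\<lambda>t. A t \<omega>)) \<and>
        (AE \<omega> in P. N 0 \<omega> = 0 \<and> A 0 \<omega> = 0) \<and>
        (AE \<omega> in P. \<forall>t\<ge>0. X t \<omega> = X 0 \<omega> + N t \<omega> + A t \<omega>))"


section \<open>The stochastic integral\<close>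

text \<open>Simple predictable processes
  \<open>\<eta> 1\<^bsub>{0}\<^esub> + \<Sum>\<^bsub>i<k\<^esub> \<xi> i 1\<^bsub>(T i, T (i+1)]\<^esub>\<close> with stopping times
  \<open>0 = T 0 \<le> \<dots> \<le> T k < \<infinity>\<close> and \<open>\<xi> i\<close> measurable with respect to the past at \<open>T i\<close>.\<close>

definition simple_data :: "'a measure \<Rightarrow> (real \<Rightarrow> 'a measure) \<Rightarrow>
    nat \<Rightarrow> (nat \<Rightarrow> 'a \<Rightarrow> real) \<Rightarrow> ('a \<Rightarrow> real) \<Rightarrow> (nat \<Rightarrow> 'a \<Rightarrow> real) \<Rightarrow> bool" where
  "simple_data P \<F> k T \<eta> \<xi> \<longleftrightarrow>
     (\<forall>i\<le>k. stopping_time \<F> (T i)) \<and>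
     (\<forall>\<omega>\<in>space P. T 0 \<omega> = 0 \<and> (\<forall>i<k. T i \<omega> \<le> T (Suc i) \<omega>)) \<and>
     \<eta> \<in> borel_measurable (\<F> 0) \<and>
     (\<forall>i<k. \<xi> i \<in> borel_measurable (filtration.pre_sigma (space P) \<F> (T i)))"

definition simple_process ::
    "nat \<Rightarrow> (nat \<Rightarrow> 'a \<Rightarrow> real) \<Rightarrow> ('a \<Rightarrow> real) \<Rightarrow> (nat \<Rightarrow> 'a \<Rightarrow> real) \<Rightarrow> real \<Rightarrow> 'a \<Rightarrow> real" where
  "simple_process k T \<eta> \<xi> t \<omega> =
     \<eta> \<omega> * indicator {0} t + (\<Sum>i<k. \<xi> i \<omega> * indicator {T i \<omega><..T (Suc i) \<omega>} t)"

definition simple_integral :: "(real \<Rightarrow> 'a \<Rightarrow> real) \<Rightarrow>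
    nat \<Rightarrow> (nat \<Rightarrow> 'a \<Rightarrow> real) \<Rightarrow> ('a \<Rightarrow> real) \<Rightarrow> (nat \<Rightarrow> 'a \<Rightarrow> real) \<Rightarrow> real \<Rightarrow> 'a \<Rightarrow> real" where
  "simple_integral X k T \<eta> \<xi> t \<omega> =
     \<eta> \<omega> * X 0 \<omega> + (\<Sum>i<k. \<xi> i \<omega> * (X (min t (T (Suc i) \<omega>)) \<omega> - X (min t (T i \<omega>)) \<omega>))"

text \<open>Uniform convergence on compacts in probability. The outer measure agrees with the
  probability whenever the event is measurable.\<close>

definition ucp :: "'a measure \<Rightarrow> (nat \<Rightarrow> real \<Rightarrow> 'a \<Rightarrow> real) \<Rightarrow> (real \<Rightarrow> 'a \<Rightarrow> real) \<Rightarrow> bool" where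
  "ucp P Z Y \<longleftrightarrow> (\<forall>t\<ge>0. \<forall>\<epsilon>>0.
     (\<lambda>n. outer_measure_of P {\<omega>\<in>space P. \<exists>s\<in>{0..t}. \<epsilon> < \<bar>Z n s \<omega> - Y s \<omega>\<bar>}) \<longlonglongrightarrow> 0)"

text \<open>\<open>has_stochastic_integral P \<F> X H Y\<close>: the process \<open>Y\<close> is (a version, up to
  indistinguishability, of) the integral process of the adapted left-continuous process \<open>H\<close> with
  right limits against the semimartingale \<open>X\<close>. The integral is the ucp-continuous extension of
  the elementary integral from the simple predictable processes, which are ucp-dense among
  the adapted left-continuous processes with right limits; so \<open>Y\<close> is the ucp-limit of the elementary
  integrals along every approximating sequence.\<close>

definition has_stochastic_integral :: "'a measure \<Rightarrow> (real \<Rightarrow> 'a measure) \<Rightarrow>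
    (real \<Rightarrow> 'a \<Rightarrow> real) \<Rightarrow> (real \<Rightarrow> 'a \<Rightarrow> real) \<Rightarrow> (real \<Rightarrow> 'a \<Rightarrow> real) \<Rightarrow> bool" where
  "has_stochastic_integral P \<F> X H Y \<longleftrightarrow>
     adapted \<F> H \<and> (AE \<omega> in P. caglad (\<lambda>t. H t \<omega>)) \<and>
     adapted \<F> Y \<and> (AE \<omega> in P. cadlag (\<lambda>t. Y t \<omega>)) \<and>
     (\<forall>k T \<eta> \<xi>. (\<forall>n. simple_data P \<F> (k n) (T n) (\<eta> n) (\<xi> n)) \<and>
        ucp P (\<lambda>n. simple_process (k n) (T n) (\<eta> n) (\<xi> n)) H \<longrightarrow>
        ucp P (\<lambda>n. simple_integral X (k n) (T n) (\<eta> n) (\<xi> n)) Y)"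

text \<open>The random variable \<open>I\<close> is almost surely equal to \<open>\<integral>\<^sub>0\<^sup>t F(t,r) dX(r)\<close>.\<close>

definition is_kernel_integral :: "'a measure \<Rightarrow> (real \<Rightarrow> 'a measure) \<Rightarrow>
    (real \<Rightarrow> real \<Rightarrow> real) \<Rightarrow> (real \<Rightarrow> 'a \<Rightarrow> real) \<Rightarrow> real \<Rightarrow> ('a \<Rightarrow> real) \<Rightarrow> bool" where
  "is_kernel_integral P \<F> F X t I \<longleftrightarrow>
     (\<exists>Y. has_stochastic_integral P \<F> X (\<lambda>r \<omega>. F t r * indicator {0..t} r) Y \<and>
          (AE \<omega> in P. I \<omega> = Y t \<omega>))"

definition normalized_modulus :: "(real \<Rightarrow> real \<Rightarrow> real) \<Rightarrow> (real \<Rightarrow> real) \<Rightarrow> real \<Rightarrow> ennreal" where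
  "normalized_modulus F m h =
     (SUP (s, t) \<in> {(s, t). 0 < s \<and> s < t \<and> t < 1 \<and> \<bar>t - s\<bar> \<le> h}. ennreal (\<bar>m t - m s\<bar> / F t s))"

end

theory Submission
  imports Defs
begin

text \<open>Because \<open>F\<close> vanishes at the diagonal and \<open>X\<close> starts at \<open>0\<close>, integration by parts gives, almost
  surely for each \<open>t\<close>, \<open>M(t) = - \<integral>\<^sub>0\<^sup>t X(r) \<partial>\<^sub>2F(t,r) dr\<close>
  (\<open>stochastic_integral_by_parts\<close>). The right-hand side is defined path by path, and both
  sides are right continuous, so they agree at all times of the unit interval simultaneously. It remains
  to study this integral for a single cadlag path \<open>x\<close> with \<open>x(0) = 0\<close>.

  For \<open>s < t\<close> the increment over \<open>[s, t]\<close> is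
  \<open>\<integral>\<^sub>s\<^sup>t x(r) k(r) dr - \<integral>\<^sub>0\<^sup>s x(r) l(r) dr\<close> with \<open>k = - \<partial>\<^sub>2F(t,\<cdot>)\<close> and \<open>l = \<partial>\<^sub>2F(t,\<cdot>) - \<partial>\<^sub>2F(s,\<cdot>)\<close>.
  Smooth variation with index in \<open>(0, 1)\<close> fixes the signs of \<open>\<partial>\<^sub>1F\<close>, \<open>\<partial>\<^sub>2F\<close> and \<open>\<partial>\<^sub>1\<partial>\<^sub>2F\<close> near the
  diagonal, so both weights are nonnegative there. The mass of \<open>k\<close> is \<open>F(t,s)\<close>. So is that of \<open>l\<close>
  on a short interval \<open>(s - \<eta>, s)\<close>, up to \<open>O(t - s)\<close>, and what lies before \<open>s - \<eta>\<close> contributes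
  \<open>O(t - s)\<close> as well. These errors are negligible, since \<open>F(t,s)\<close> dominates a power of \<open>t - s\<close> with
  exponent below \<open>1\<close>. Hence the increment divided by \<open>F(t,s)\<close> is nearly a mean of \<open>x\<close> just after \<open>s\<close> minus
  a mean of \<open>x\<close> just before \<open>s\<close> (\<open>kernel_path_increment\<close>,
  \<open>kernel_path_increment_estimate\<close>).

  This difference is at most the oscillation of \<open>x\<close> over a short interval, which for a cadlag
  path exceeds the largest jump by arbitrarily little (\<open>cadlag_oscillation\<close>); and if \<open>s\<close> is a
  jump time and \<open>t\<close> decreases to \<open>s\<close>, it converges to the jump. For \<open>s\<close> close to \<open>0\<close> there is no room for
  the interval \<open>(s - \<eta>, s)\<close>, but there \<open>x\<close> itself is small and the masses are at most
  \<open>F(t,s)\<close>.\<close>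

section \<open>Cadlag paths\<close>

lemma cadlag_local:
  assumes "cadlag x" "0 \<le> p" "0 < e"
  obtains \<delta> where "0 < \<delta>"
    and "\<And>u. p \<le> u \<Longrightarrow> u < p + \<delta> \<Longrightarrow> \<bar>x u - x p\<bar> < e"
    and "\<And>u. 0 \<le> u \<Longrightarrow> p - \<delta> < u \<Longrightarrow> u < p \<Longrightarrow> \<bar>x u - (x p - jump x p)\<bar> < e"
proof -
  have "(x \<longlongrightarrow> x p) (at_right p)"
    using assms by (simp add: cadlag_def)
  then have "\<forall>\<^sub>F u in at_right p. dist (x u) (x p) < e"
    using assms(3) by (rule tendstoD)
  then obtain b where b: "b > p" "\<And>u. p < u \<Longrightarrow> u < b \<Longrightarrow> \<bar>x u - x p\<bar> < e"
    unfolding eventually_at_right_field dist_real_def by auto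
  have right: "\<bar>x u - x p\<bar> < e" if "p \<le> u" "u < b" for u
    using b(2)[of u] that assms(3) by (cases "u = p") auto
  show thesis
  proof (cases "p = 0")
    case True
    show thesis
      by (rule that[of "b - p"]) (use b(1) right True in auto)
  next
    case False
    then have "0 < p" using assms(2) by simp
    then obtain l where l: "(x \<longlongrightarrow> l) (at_left p)"
      using assms(1) by (auto simp: cadlag_def)
    have jl: "x p - jump x p = l"
      using tendsto_Lim[OF trivial_limit_at_left_real l] False by (simp add: jump_def)
    have "\<forall>\<^sub>F u in at_left p. dist (x u) l < e"
      using l assms(3) by (rule tendstoD)
    then obtain a where a: "a < p" "\<And>u. a < u \<Longrightarrow> u < p \<Longrightarrow> \<bar>x u - l\<bar> < e"
      unfolding eventually_at_left_field dist_real_def by auto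
    show thesis
      by (rule that[of "min (b - p) (p - a)"]) (use a b(1) right jl in auto)
  qed
qed

lemma cadlag_bounded:
  assumes "cadlag x"
  obtains B where "0 \<le> B" "\<And>r. 0 \<le> r \<Longrightarrow> r \<le> T \<Longrightarrow> \<bar>x r\<bar> \<le> B"
proof -
  define b where "b p = \<bar>x p\<bar> + \<bar>jump x p\<bar> + 1" for p
  have "\<forall>p\<in>{0..T}. \<exists>\<delta>>0. \<forall>u. 0 \<le> u \<and> \<bar>u - p\<bar> < \<delta> \<longrightarrow> \<bar>x u\<bar> \<le> b p"
  proof
    fix p assume "p \<in> {0..T}"
    then obtain \<delta> where "0 < \<delta>"
      and "\<And>u. p \<le> u \<Longrightarrow> u < p + \<delta> \<Longrightarrow> \<bar>x u - x p\<bar> < 1"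
      and "\<And>u. 0 \<le> u \<Longrightarrow> p - \<delta> < u \<Longrightarrow> u < p \<Longrightarrow> \<bar>x u - (x p - jump x p)\<bar> < 1"
      using cadlag_local[OF assms, of p 1] by auto
    then show "\<exists>\<delta>>0. \<forall>u. 0 \<le> u \<and> \<bar>u - p\<bar> < \<delta> \<longrightarrow> \<bar>x u\<bar> \<le> b p"
      unfolding b_def by (intro exI[of _ \<delta>]) (smt (verit))
  qed
  then obtain \<delta> where \<delta>: "\<And>p. p \<in> {0..T} \<Longrightarrow> 0 < \<delta> p"
    and loc: "\<And>p u. p \<in> {0..T} \<Longrightarrow> 0 \<le> u \<Longrightarrow> \<bar>u - p\<bar> < \<delta> p \<Longrightarrow> \<bar>x u\<bar> \<le> b p"
    by metis
  have "{0..T} \<subseteq> (\<Union>p\<in>{0..T}. ball p (\<delta> p))"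
    using \<delta> by (auto intro!: bexI)
  then obtain D where D: "D \<subseteq> {0..T}" "finite D" "{0..T} \<subseteq> (\<Union>p\<in>D. ball p (\<delta> p))"
    using compactE_image[OF compact_Icc[of 0 T], of "{0..T}" "\<lambda>p. ball p (\<delta> p)"]
    by (metis open_ball)
  have b0: "0 \<le> b p" for p
    by (simp add: b_def)
  show thesis
  proof (rule that[of "sum b D"])
    show "0 \<le> sum b D"
      by (intro sum_nonneg b0)
    fix r assume "0 \<le> r" "r \<le> T"
    then obtain p where p: "p \<in> D" "r \<in> ball p (\<delta> p)"
      using D(3) by fastforce
    then have "\<bar>x r\<bar> \<le> b p"
      using loc[of p r] D(1) \<open>0 \<le> r\<close> by (auto simp: dist_real_def abs_minus_commute)
    also have "\<dots> \<le> sum b D"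
      using p(1) D(2) b0 by (intro member_le_sum) auto
    finally show "\<bar>x r\<bar> \<le> sum b D" .
  qed
qed

lemma cadlag_jump_bounded:
  assumes x: "cadlag x"
  obtains B where "0 \<le> B" "\<And>s. 0 \<le> s \<Longrightarrow> s \<le> T \<Longrightarrow> \<bar>jump x s\<bar> \<le> B"
proof -
  obtain B where B: "0 \<le> B" "\<And>r. 0 \<le> r \<Longrightarrow> r \<le> T \<Longrightarrow> \<bar>x r\<bar> \<le> B"
    using cadlag_bounded[OF x] by blast
  show thesis
  proof (rule that[of "2 * B + 1"])
    fix s assume s: "0 \<le> s" "s \<le> T"
    show "\<bar>jump x s\<bar> \<le> 2 * B + 1"
    proof (cases "s = 0")
      case True
      then show ?thesis using B s by (force simp: jump_def)
    next
      case False
      obtain \<gamma> where \<gamma>: "0 < \<gamma>"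
        "\<And>u. 0 \<le> u \<Longrightarrow> s - \<gamma> < u \<Longrightarrow> u < s \<Longrightarrow> \<bar>x u - (x s - jump x s)\<bar> < 1"
        using cadlag_local[OF x s(1) zero_less_one] by metis
      define u where "u = max 0 (s - \<gamma> / 2)"
      have "0 \<le> u" "s - \<gamma> < u" "u < s" using \<gamma>(1) s False by (auto simp: u_def)
      then show ?thesis using \<gamma>(2)[of u] B(2)[of u] B(2)[of s] s by linarith
    qed
  qed (use B in simp)
qed

text \<open>The two one-sided limits at a point differ by the jump there, so near each point the
  oscillation exceeds the jump by less than any prescribed amount; a Lebesgue number of the
  resulting cover makes this uniform. The right endpoint is left out of the range of \<open>u\<close> and \<open>v\<close>,
  so a jump at time \<open>T\<close> is not seen.\<close>

lemma cadlag_oscillation: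
  assumes x: "cadlag x" and e: "0 < e"
    and J: "\<And>s. 0 \<le> s \<Longrightarrow> s < T \<Longrightarrow> \<bar>jump x s\<bar> \<le> J"
  obtains \<eta> where "0 < \<eta>"
    and "\<And>u v. 0 \<le> u \<Longrightarrow> u < T \<Longrightarrow> 0 \<le> v \<Longrightarrow> v < T \<Longrightarrow> \<bar>u - v\<bar> < \<eta> \<Longrightarrow> \<bar>x u - x v\<bar> \<le> J + e"
proof -
  have "\<forall>p\<in>{0..T}. \<exists>\<delta>>0. \<forall>u v. 0 \<le> u \<and> u < T \<and> 0 \<le> v \<and> v < T \<and>
          \<bar>u - p\<bar> < \<delta> \<and> \<bar>v - p\<bar> < \<delta> \<longrightarrow> \<bar>x u - x v\<bar> \<le> J + e"
  proof
    fix p assume p: "p \<in> {0..T}"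
    then obtain \<delta> where \<delta>: "0 < \<delta>"
      and R: "\<And>u. p \<le> u \<Longrightarrow> u < p + \<delta> \<Longrightarrow> \<bar>x u - x p\<bar> < e / 2"
      and L: "\<And>u. 0 \<le> u \<Longrightarrow> p - \<delta> < u \<Longrightarrow> u < p \<Longrightarrow> \<bar>x u - (x p - jump x p)\<bar> < e / 2"
      using cadlag_local[OF x, of p "e / 2"] e by auto
    have "\<bar>x u - x v\<bar> \<le> J + e"
      if uv: "0 \<le> u" "u < T" "0 \<le> v" "v < T" "\<bar>u - p\<bar> < \<delta>" "\<bar>v - p\<bar> < \<delta>" for u v
    proof -
      have "0 \<le> J" using J[of u] uv by linarith
      moreover have "\<bar>jump x p\<bar> \<le> J" if "p < T" using J[of p] p that by auto
      ultimately show ?thesis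
        using R[of u] R[of v] L[of u] L[of v] uv
        by (smt (verit) field_sum_of_halves)
    qed
    with \<delta> show "\<exists>\<delta>>0. \<forall>u v. 0 \<le> u \<and> u < T \<and> 0 \<le> v \<and> v < T \<and>
          \<bar>u - p\<bar> < \<delta> \<and> \<bar>v - p\<bar> < \<delta> \<longrightarrow> \<bar>x u - x v\<bar> \<le> J + e"
      by blast
  qed
  then obtain \<delta> where \<delta>: "\<And>p. p \<in> {0..T} \<Longrightarrow> 0 < \<delta> p"
    and loc: "\<And>p u v. p \<in> {0..T} \<Longrightarrow> 0 \<le> u \<Longrightarrow> u < T \<Longrightarrow> 0 \<le> v \<Longrightarrow> v < T \<Longrightarrow>
       \<bar>u - p\<bar> < \<delta> p \<Longrightarrow> \<bar>v - p\<bar> < \<delta> p \<Longrightarrow> \<bar>x u - x v\<bar> \<le> J + e"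
    by metis
  have "{0..T} \<subseteq> \<Union> ((\<lambda>p. ball p (\<delta> p)) ` {0..T})"
    using \<delta> by auto
  then obtain \<eta> where \<eta>: "0 < \<eta>"
    "\<And>u. u \<in> {0..T} \<Longrightarrow> \<exists>G \<in> (\<lambda>p. ball p (\<delta> p)) ` {0..T}. ball u \<eta> \<subseteq> G"
    by (rule Heine_Borel_lemma[OF compact_Icc]) auto
  show thesis
  proof (rule that[OF \<eta>(1)])
    fix u v assume uv: "0 \<le> u" "u < T" "0 \<le> v" "v < T" "\<bar>u - v\<bar> < \<eta>"
    then obtain p where p: "p \<in> {0..T}" "ball u \<eta> \<subseteq> ball p (\<delta> p)"
      using \<eta>(2)[of u] by auto
    have "u \<in> ball p (\<delta> p)" "v \<in> ball p (\<delta> p)"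
      using p(2) \<eta>(1) uv(5) by (auto simp: subset_iff dist_real_def)
    then show "\<bar>x u - x v\<bar> \<le> J + e"
      using loc[OF p(1) uv(1-4)] by (simp add: dist_real_def abs_minus_commute)
  qed
qed

section \<open>Integration by parts against a cadlag path\<close>

text \<open>The comparison is asked only inside the interval, since the derivative of the kernel has an
  arbitrary value at the diagonal.\<close>

lemma abs_integral_le:
  fixes f g :: "real \<Rightarrow> real"
  assumes "f integrable_on {a..b}" "(g has_integral I) {a..b}"
    and "\<And>r. a < r \<Longrightarrow> r < b \<Longrightarrow> \<bar>f r\<bar> \<le> g r"
  shows "\<bar>integral {a..b} f\<bar> \<le> I"
proof -
  have "(f has_integral integral {a..b} f) {a<..<b}"
    using assms(1) has_integral_Icc_iff_Ioo by blast
  moreover have g: "(g has_integral I) {a<..<b}"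
    using assms(2) has_integral_Icc_iff_Ioo by blast
  ultimately have "norm (integral {a<..<b} f) \<le> integral {a<..<b} g"
    by (intro integral_norm_bound_integral) (use assms(3) in auto)
  then show ?thesis
    using g \<open>(f has_integral integral {a..b} f) {a<..<b}\<close> by (simp add: integral_unique)
qed

lemma right_continuous_seq:
  fixes x :: "real \<Rightarrow> real"
  assumes "(x \<longlongrightarrow> x r) (at_right r)" "\<And>n. r \<le> y n" "y \<longlonglongrightarrow> r"
  shows "(\<lambda>n. x (y n)) \<longlonglongrightarrow> x r"
proof -
  have "continuous (at r within {r..}) x"
    using assms(1) by (simp add: continuous_within at_within_Ici_at_right)
  then show ?thesis
    using assms(2,3) by (auto simp: continuous_within_sequentially o_def)
qed

lemma has_integral_step_times_derivative:
  fixes G g y :: "real \<Rightarrow> real" and T :: "nat \<Rightarrow> real"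
  assumes "\<And>i. i < m \<Longrightarrow> T i \<le> T (Suc i)" "continuous_on {T 0..T m} G"
    and "\<And>r. T 0 < r \<Longrightarrow> r < T m \<Longrightarrow> (G has_real_derivative g r) (at r)"
    and "\<And>i r. i < m \<Longrightarrow> T i < r \<Longrightarrow> r < T (Suc i) \<Longrightarrow> y r = c i"
  shows "T 0 \<le> T m \<and> ((\<lambda>r. y r * g r) has_integral (\<Sum>i<m. c i * (G (T (Suc i)) - G (T i)))) {T 0..T m}"
  using assms
proof (induction m)
  case 0
  then show ?case using has_integral_refl(2)[of "\<lambda>r. y r * g r" "T 0"] by simp
next
  case (Suc m)
  have step: "T m \<le> T (Suc m)" using Suc.prems(1) by blast
  have IH: "T 0 \<le> T m \<and>
      ((\<lambda>r. y r * g r) has_integral (\<Sum>i<m. c i * (G (T (Suc i)) - G (T i)))) {T 0..T m}"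
  proof (rule Suc.IH)
    show "continuous_on {T 0..T m} G"
      using step by (intro continuous_on_subset[OF Suc.prems(2)]) auto
    show "(G has_real_derivative g r) (at r)" if "T 0 < r" "r < T m" for r
      using that step by (intro Suc.prems(3)) auto
  qed (use Suc.prems(1,4) less_SucI in blast)+
  have "(g has_integral (G (T (Suc m)) - G (T m))) {T m..T (Suc m)}"
  proof (rule fundamental_theorem_of_calculus_interior[OF step])
    show "continuous_on {T m..T (Suc m)} G"
      using IH by (intro continuous_on_subset[OF Suc.prems(2)]) auto
    show "(G has_vector_derivative g r) (at r)" if "r \<in> {T m<..<T (Suc m)}" for r
      using that IH Suc.prems(3)[of r] by (simp add: has_real_derivative_iff_has_vector_derivative)
  qed
  then have "((\<lambda>r. c m * g r) has_integral c m * (G (T (Suc m)) - G (T m))) {T m<..<T (Suc m)}"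
    unfolding has_integral_Icc_iff_Ioo by (rule has_integral_mult_right)
  then have "((\<lambda>r. y r * g r) has_integral c m * (G (T (Suc m)) - G (T m))) {T m<..<T (Suc m)}"
    by (rule has_integral_eq[rotated]) (simp add: Suc.prems(4)[of m])
  then have "((\<lambda>r. y r * g r) has_integral c m * (G (T (Suc m)) - G (T m))) {T m..T (Suc m)}"
    unfolding has_integral_Icc_iff_Ioo .
  from has_integral_combine[OF _ step conjunct2[OF IH] this] IH step show ?case by simp
qed

text \<open>Replacing \<open>x\<close> by its value at the right end of each partition interval turns the integral
  into a sum of increments of \<open>G\<close>; right continuity makes these step functions converge
  pointwise, and \<open>B * \<bar>g\<bar>\<close> dominates. Dominated convergence for the gauge integral
  also yields the integrability of the limit.\<close>

lemma stieltjes_sums_tendsto: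
  fixes x G g :: "real \<Rightarrow> real"
  assumes t: "0 < t" and x: "cadlag x"
    and G: "continuous_on {0..t} G"
    and g: "\<And>r. 0 < r \<Longrightarrow> r < t \<Longrightarrow> (G has_real_derivative g r) (at r)"
    and abs_g: "(\<lambda>r. \<bar>g r\<bar>) integrable_on {0..t}"
  shows "(\<lambda>r. x r * g r) integrable_on {0..t}"
    and "(\<lambda>n. \<Sum>i<Suc n. x (t * real (Suc i) / real (Suc n)) *
            (G (t * real (Suc i) / real (Suc n)) - G (t * real i / real (Suc n))))
          \<longlonglongrightarrow> integral {0..t} (\<lambda>r. x r * g r)"
proof -
  obtain B where B: "0 \<le> B" "\<And>r. 0 \<le> r \<Longrightarrow> r \<le> t \<Longrightarrow> \<bar>x r\<bar> \<le> B"
    using cadlag_bounded[OF x] by blast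
  define \<tau> where "\<tau> n i = t * real i / real (Suc n)" for n i
  define up where "up n r = t * of_int \<lceil>r * real (Suc n) / t\<rceil> / real (Suc n)" for n r
  have up_ge: "r \<le> up n r" for n r
  proof -
    have "r * real (Suc n) / t \<le> of_int \<lceil>r * real (Suc n) / t\<rceil>" by simp
    then show ?thesis using t by (simp add: up_def field_simps del: of_nat_Suc le_of_int_ceiling)
  qed
  have up_le: "up n r \<le> r + t / real (Suc n)" for n r
  proof -
    have "of_int \<lceil>r * real (Suc n) / t\<rceil> \<le> r * real (Suc n) / t + 1"
      using of_int_ceiling_le_add_one by blast
    then show ?thesis using t by (simp add: up_def field_simps del: of_nat_Suc)
  qed
  have up_t: "up n r \<le> t" if "r \<le> t" for n r
  proof -
    have "\<lceil>r * real (Suc n) / t\<rceil> \<le> int (Suc n)"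
      using that t by (simp add: ceiling_le_iff field_simps del: of_nat_Suc)
    then have "of_int \<lceil>r * real (Suc n) / t\<rceil> \<le> real (Suc n)"
      by linarith
    then show ?thesis using t by (simp add: up_def field_simps del: of_nat_Suc)
  qed
  have up_lim: "(\<lambda>n. up n r) \<longlonglongrightarrow> r" for r
  proof (rule tendsto_sandwich[where f = "\<lambda>_. r" and h = "\<lambda>n. r + t / real (Suc n)"])
    have "(\<lambda>n. r + t * inverse (real (Suc n))) \<longlonglongrightarrow> r + t * 0"
      by (intro tendsto_intros LIMSEQ_inverse_real_of_nat)
    then show "(\<lambda>n. r + t / real (Suc n)) \<longlonglongrightarrow> r"
      by (simp add: divide_inverse)
  qed (rule always_eventually allI up_ge up_le tendsto_const)+
  have up_step: "up n r = \<tau> n (Suc i)" if "\<tau> n i < r" "r < \<tau> n (Suc i)" for n i r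
  proof -
    have "real i < r * real (Suc n) / t" "r * real (Suc n) / t < real i + 1"
      using that t by (auto simp: \<tau>_def field_simps)
    then have "\<lceil>r * real (Suc n) / t\<rceil> = int i + 1"
      by (intro ceiling_unique) auto
    then show ?thesis by (simp add: up_def \<tau>_def)
  qed
  have \<tau>0: "\<tau> n 0 = 0" and \<tau>t: "\<tau> n (Suc n) = t" for n
    by (auto simp: \<tau>_def)
  have hi: "((\<lambda>r. x (up n r) * g r) has_integral
      (\<Sum>i<Suc n. x (\<tau> n (Suc i)) * (G (\<tau> n (Suc i)) - G (\<tau> n i)))) {0..t}" for n
    using has_integral_step_times_derivative[of "Suc n" "\<tau> n" G g "\<lambda>r. x (up n r)"
        "\<lambda>i. x (\<tau> n (Suc i))"] t G g up_step
    by (auto simp: \<tau>0 \<tau>t) (auto simp: \<tau>_def divide_right_mono mult_left_mono)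
  have dom: "(\<lambda>r. B * \<bar>g r\<bar>) integrable_on {0..t}"
    using integrable_cmul[OF abs_g, of B] by simp
  have bound: "norm (x (up n r) * g r) \<le> B * \<bar>g r\<bar>" if "r \<in> {0..t}" for n r
    using B(2)[of "up n r"] up_ge[of r n] up_t[of r n] that
    by (auto simp: abs_mult intro!: mult_right_mono)
  have lim: "(\<lambda>n. x (up n r) * g r) \<longlonglongrightarrow> x r * g r" if "r \<in> {0..t}" for r
  proof (rule tendsto_mult_right, rule right_continuous_seq[OF _ up_ge up_lim])
    show "(x \<longlongrightarrow> x r) (at_right r)"
      using x that by (simp add: cadlag_def)
  qed
  show "(\<lambda>r. x r * g r) integrable_on {0..t}"
    by (rule dominated_convergence(1)[OF has_integral_integrable[OF hi] dom bound lim])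
  have "(\<lambda>n. integral {0..t} (\<lambda>r. x (up n r) * g r)) \<longlonglongrightarrow> integral {0..t} (\<lambda>r. x r * g r)"
    by (rule dominated_convergence(2)[OF has_integral_integrable[OF hi] dom bound lim])
  then show "(\<lambda>n. \<Sum>i<Suc n. x (t * real (Suc i) / real (Suc n)) *
            (G (t * real (Suc i) / real (Suc n)) - G (t * real i / real (Suc n))))
          \<longlonglongrightarrow> integral {0..t} (\<lambda>r. x r * g r)"
    unfolding integral_unique[OF hi] \<tau>_def .
qed

section \<open>Kernels near the diagonal\<close>

text \<open>What the pathwise argument needs of the kernel. Up to distance \<open>\<delta>\<close> from the diagonal, over
  the unit interval, the kernel vanishes at the diagonal, the derivatives have fixed signs, and
  the kernel dominates a power \<open>q < 1\<close> of the distance, so an error of order \<open>t - s\<close> is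
  negligible against \<open>F t s\<close>.\<close>

locale diagonal_kernel =
  fixes F :: "real \<Rightarrow> real \<Rightarrow> real" and \<delta> c q :: real
  assumes cont: "continuous_on E_closed (\<lambda>(s, r). F s r)"
    and pos: "\<And>s r. r < s \<Longrightarrow> 0 < F s r"
    and deriv_fst: "\<And>s r. r < s \<Longrightarrow> ((\<lambda>u. F u r) has_real_derivative d_fst F s r) (at s)"
    and deriv_snd: "\<And>s r. r < s \<Longrightarrow> (F s has_real_derivative d_snd F s r) (at r)"
    and deriv_mixed: "\<And>s r. r < s \<Longrightarrow>
      ((\<lambda>u. d_snd F u r) has_real_derivative d_fst (d_snd F) s r) (at s)"
    and cont_snd: "\<And>s r. r < s \<Longrightarrow> isCont (d_snd F s) r"
    and cont_mixed: "continuous_on E_open (\<lambda>(s, r). d_fst (d_snd F) s r)"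
    and \<delta>: "0 < \<delta>" and c: "0 < c" and q: "q < 1"
    and diag: "\<And>s. 0 \<le> s \<Longrightarrow> s \<le> 1 \<Longrightarrow> F s s = 0"
    and snd_neg: "\<And>s r. 0 \<le> s \<Longrightarrow> s \<le> 1 \<Longrightarrow> r < s \<Longrightarrow> s - r \<le> \<delta> \<Longrightarrow> d_snd F s r < 0"
    and fst_pos: "\<And>s r. 0 \<le> r \<Longrightarrow> r \<le> 1 \<Longrightarrow> r < s \<Longrightarrow> s - r \<le> \<delta> \<Longrightarrow> 0 < d_fst F s r"
    and fst_le: "\<And>s r. 0 \<le> r \<Longrightarrow> r \<le> 1 \<Longrightarrow> r < s \<Longrightarrow> s - r \<le> \<delta> \<Longrightarrow>
      d_fst F s r \<le> F s r / (s - r)"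
    and mixed_pos: "\<And>s r. 0 \<le> s \<Longrightarrow> s \<le> 1 \<Longrightarrow> r < s \<Longrightarrow> s - r \<le> \<delta> \<Longrightarrow> 0 < d_fst (d_snd F) s r"
    and lower: "\<And>s r. 0 \<le> s \<Longrightarrow> s \<le> 1 \<Longrightarrow> r < s \<Longrightarrow> s - r \<le> \<delta> \<Longrightarrow> c * (s - r) powr q \<le> F s r"

lemma SUP_tendsto_0_uniform:
  fixes f :: "real \<Rightarrow> real \<Rightarrow> real"
  assumes "((\<lambda>h. SUP t\<in>K. ennreal \<bar>f h t\<bar>) \<longlongrightarrow> 0) (at_right 0)" "0 < e"
  shows "\<forall>\<^sub>F h in at_right 0. \<forall>t\<in>K. \<bar>f h t\<bar> < e"
proof -
  have "\<forall>\<^sub>F h in at_right 0. (SUP t\<in>K. ennreal \<bar>f h t\<bar>) < ennreal e"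
    using assms by (intro order_tendstoD(2)) auto
  then show ?thesis
  proof (rule eventually_mono, intro ballI)
    fix h t assume h: "(SUP t\<in>K. ennreal \<bar>f h t\<bar>) < ennreal e" and t: "t \<in> K"
    have "ennreal \<bar>f h t\<bar> < ennreal e"
      using SUP_upper[OF t, of "\<lambda>t. ennreal \<bar>f h t\<bar>"] h by (rule le_less_trans)
    then show "\<bar>f h t\<bar> < e"
      by (simp add: ennreal_less_iff)
  qed
qed

text \<open>Regular variation in integrated form: if the logarithmic derivative of \<open>\<phi>\<close> is at most
  \<open>a / h\<close>, then \<open>\<phi> h / h powr a\<close> decreases.\<close>

lemma power_bound_of_log_derivative_le:
  fixes \<phi> :: "real \<Rightarrow> real"
  assumes "0 < h" "h \<le> \<delta>"
    and \<phi>: "\<And>y. h \<le> y \<Longrightarrow> y \<le> \<delta> \<Longrightarrow> 0 < \<phi> y"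
    and D: "\<And>y. h \<le> y \<Longrightarrow> y \<le> \<delta> \<Longrightarrow> (\<phi> has_real_derivative \<phi>' y) (at y)"
    and le: "\<And>y. h \<le> y \<Longrightarrow> y \<le> \<delta> \<Longrightarrow> y * \<phi>' y / \<phi> y \<le> a"
  shows "\<phi> \<delta> * (h / \<delta>) powr a \<le> \<phi> h"
proof -
  have "a * ln h - ln (\<phi> h) \<le> a * ln \<delta> - ln (\<phi> \<delta>)"
  proof (rule DERIV_nonneg_imp_nondecreasing[OF assms(2), of "\<lambda>y. a * ln y - ln (\<phi> y)"])
    fix y assume y: "h \<le> y" "y \<le> \<delta>"
    have "y * \<phi>' y \<le> a * \<phi> y"
      using le[OF y] \<phi>[OF y] by (simp add: field_simps)
    then have "0 \<le> a * (1 / y) - 1 / \<phi> y * \<phi>' y"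
      using \<phi>[OF y] y assms(1) by (simp add: field_simps)
    moreover have "((\<lambda>y. a * ln y - ln (\<phi> y)) has_real_derivative
        (a * (1 / y) - 1 / \<phi> y * \<phi>' y)) (at y)"
      using \<phi>[OF y] y assms(1) D[OF y] by (auto intro!: derivative_eq_intros simp: field_simps)
    ultimately show "\<exists>D. ((\<lambda>y. a * ln y - ln (\<phi> y)) has_real_derivative D) (at y) \<and> 0 \<le> D"
      by blast
  qed
  then have "ln (\<phi> \<delta>) + a * (ln h - ln \<delta>) \<le> ln (\<phi> h)"
    by (simp add: algebra_simps)
  then have "exp (ln (\<phi> \<delta>) + a * (ln h - ln \<delta>)) \<le> exp (ln (\<phi> h))"
    by simp
  then show ?thesis
    using assms(1,2) \<phi>[of h] \<phi>[of \<delta>] by (simp add: exp_add powr_def ln_div)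
qed

lemma power_bound_of_log_derivative_ge:
  fixes \<phi> :: "real \<Rightarrow> real"
  assumes "0 < h" "h \<le> \<delta>"
    and \<phi>: "\<And>y. h \<le> y \<Longrightarrow> y \<le> \<delta> \<Longrightarrow> 0 < \<phi> y"
    and D: "\<And>y. h \<le> y \<Longrightarrow> y \<le> \<delta> \<Longrightarrow> (\<phi> has_real_derivative \<phi>' y) (at y)"
    and ge: "\<And>y. h \<le> y \<Longrightarrow> y \<le> \<delta> \<Longrightarrow> a \<le> y * \<phi>' y / \<phi> y"
  shows "\<phi> h \<le> \<phi> \<delta> * (h / \<delta>) powr a"
proof -
  \<comment> \<open>The reciprocal of \<open>\<phi>\<close> has logarithmic derivative at most \<open>- a / h\<close>.\<close>
  have "inverse (\<phi> \<delta>) * (h / \<delta>) powr (- a) \<le> inverse (\<phi> h)"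
  proof (rule power_bound_of_log_derivative_le[OF assms(1,2),
        where \<phi>' = "\<lambda>y. - (inverse (\<phi> y) * \<phi>' y * inverse (\<phi> y))"])
    fix y assume y: "h \<le> y" "y \<le> \<delta>"
    show "0 < inverse (\<phi> y)" using \<phi>[OF y] by simp
    show "((\<lambda>y. inverse (\<phi> y)) has_real_derivative - (inverse (\<phi> y) * \<phi>' y * inverse (\<phi> y))) (at y)"
      using DERIV_inverse'[OF D[OF y]] \<phi>[OF y] by simp
    show "y * - (inverse (\<phi> y) * \<phi>' y * inverse (\<phi> y)) / inverse (\<phi> y) \<le> - a"
      using ge[OF y] \<phi>[OF y] by (simp add: field_simps)
  qed
  then show ?thesis
    using assms(1,2) \<phi>[of h] \<phi>[of \<delta>] by (simp add: powr_minus field_simps)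
qed

lemma continuous_on_kernel_section:
  assumes "continuous_on E_closed (\<lambda>(s, r). F s r)" "b \<le> s"
  shows "continuous_on {a..b} (F s)"
proof -
  have "continuous_on ((\<lambda>r. (s, r)) ` {a..b}) (\<lambda>(s, r). F s r)"
    using assms(2) by (intro continuous_on_subset[OF assms(1)]) (auto simp: E_closed_def)
  then have "continuous_on {a..b} ((\<lambda>(s, r). F s r) \<circ> (\<lambda>r. (s, r)))"
    by (intro continuous_on_compose continuous_intros)
  then show ?thesis by (simp add: o_def)
qed

text \<open>The conditions of smooth variation on the first derivatives give their signs and, integrated, the power
  bounds. The mixed condition gives a positive sign because its limit \<open>d * (1 - d)\<close> is
  positive for \<open>0 < d < 1\<close>.\<close>

lemma smooth_variation_imp_diagonal_kernel:
  assumes sv: "smooth_variation d F" and d: "0 < d" "d < 1"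
  obtains \<delta> c q where "diagonal_kernel F \<delta> c q"
proof -
  have C: "C_plus 2 F" using sv by (simp add: smooth_variation_def)
  have cont: "continuous_on E_closed (\<lambda>(s, r). F s r)"
    and pos: "\<And>s r. r < s \<Longrightarrow> 0 < F s r"
    and cp: "cont_partials (Suc (Suc 0)) F"
    using C by (auto simp: C_plus_def E_open_def numeral_2_eq_2 simp del: cont_partials.simps)
  have df: "r < s \<Longrightarrow> ((\<lambda>u. F u r) has_real_derivative d_fst F s r) (at s)"
    and ds: "r < s \<Longrightarrow> (F s has_real_derivative d_snd F s r) (at r)"
    and dfs: "r < s \<Longrightarrow> ((\<lambda>u. d_snd F u r) has_real_derivative d_fst (d_snd F) s r) (at s)"
    and dss: "r < s \<Longrightarrow> (d_snd F s has_real_derivative d_snd (d_snd F) s r) (at r)"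
    and cm: "continuous_on E_open (\<lambda>(s, r). d_fst (d_snd F) s r)" for r s
    using cp by (auto simp: E_open_def d_fst_def[abs_def] d_snd_def[abs_def]
        DERIV_deriv_iff_real_differentiable)
  \<comment> \<open>With this tolerance, \<open>0 < d - e\<close> makes the kernel vanish at the diagonal, and \<open>d + e < 1\<close> is the
    exponent of the lower bound.\<close>
  define e where "e = min d (1 - d) / 2"
  have e: "0 < e" "e < d" "d + e < 1" using d by (auto simp: e_def min_def field_simps)
  have dd: "0 < d * (1 - d)" using d by simp
  note sv' = conjunct2[OF sv[unfolded smooth_variation_def], rule_format, OF compact_Icc[of 0 1]]
  have "\<forall>\<^sub>F h in at_right 0.
      (\<forall>t\<in>{0..1}. \<bar>h * partial 0 1 F t (t - h) / F t (t - h) + d\<bar> < e) \<and>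
      (\<forall>t\<in>{0..1}. \<bar>h * partial 1 0 F (t + h) t / F (t + h) t - d\<bar> < e) \<and>
      (\<forall>t\<in>{0..1}. \<bar>h\<^sup>2 * partial 1 1 F t (t - h) / F t (t - h) + d * (d - 1)\<bar> < d * (1 - d))"
    using sv' e(1) dd by (intro eventually_conj SUP_tendsto_0_uniform) auto
  then obtain b where b: "b > 0"
    and A: "\<And>h t. 0 < h \<Longrightarrow> h < b \<Longrightarrow> t \<in> {0..1} \<Longrightarrow> \<bar>h * d_snd F t (t - h) / F t (t - h) + d\<bar> < e"
    and B: "\<And>h t. 0 < h \<Longrightarrow> h < b \<Longrightarrow> t \<in> {0..1} \<Longrightarrow> \<bar>h * d_fst F (t + h) t / F (t + h) t - d\<bar> < e"
    and M: "\<And>h t. 0 < h \<Longrightarrow> h < b \<Longrightarrow> t \<in> {0..1} \<Longrightarrow>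
      \<bar>h\<^sup>2 * d_fst (d_snd F) t (t - h) / F t (t - h) + d * (d - 1)\<bar> < d * (1 - d)"
    unfolding eventually_at_right_field partial_def by auto
  define \<delta> where "\<delta> = b / 2"
  have \<delta>: "0 < \<delta>" "\<delta> < b" using b by (auto simp: \<delta>_def)
  have "continuous_on ((\<lambda>t. (t, t - \<delta>)) ` {0..1}) (\<lambda>(s, r). F s r)"
    using \<delta> by (intro continuous_on_subset[OF cont]) (auto simp: E_closed_def)
  then have "continuous_on {0..1} ((\<lambda>(s, r). F s r) \<circ> (\<lambda>t. (t, t - \<delta>)))"
    by (intro continuous_on_compose continuous_intros)
  then have cF: "continuous_on {0..1} (\<lambda>t. F t (t - \<delta>))" by (simp add: o_def)
  obtain t0 where t0: "t0 \<in> {0..1}" "\<And>t. t \<in> {0..1} \<Longrightarrow> F t0 (t0 - \<delta>) \<le> F t (t - \<delta>)"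
    using continuous_attains_inf[OF compact_Icc _ cF] by auto
  have D: "((\<lambda>y. F t (t - y)) has_real_derivative - d_snd F t (t - y)) (at y)" if "0 < y" for t y
  proof -
    have "((\<lambda>y. t - y) has_real_derivative - 1) (at y)"
      by (auto intro!: derivative_eq_intros)
    then show ?thesis
      using DERIV_chain2[of "F t" "d_snd F t (t - y)" "\<lambda>y. t - y" y "- 1" UNIV]
        ds[of "t - y" t] that by (simp only: mult_minus1_right)
  qed
  have up: "F t (t - h) \<le> F t (t - \<delta>) * (h / \<delta>) powr (d - e)"
    and lo: "F t (t - \<delta>) * (h / \<delta>) powr (d + e) \<le> F t (t - h)"
    if t: "t \<in> {0..1}" and h: "0 < h" "h \<le> \<delta>" for t h
  proof -
    have y: "\<bar>y * - d_snd F t (t - y) / F t (t - y) - d\<bar> < e" if "h \<le> y" "y \<le> \<delta>" for y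
      using A[of y t] that t h \<delta> by (auto simp: abs_if split: if_splits)
    have F: "0 < F t (t - y)" and D': "((\<lambda>y. F t (t - y)) has_real_derivative - d_snd F t (t - y)) (at y)"
      if "h \<le> y" for y
      using D[of y t] pos[of "t - y" t] that h by auto
    show "F t (t - h) \<le> F t (t - \<delta>) * (h / \<delta>) powr (d - e)"
    proof (rule power_bound_of_log_derivative_ge[OF h F D'])
      show "d - e \<le> y * - d_snd F t (t - y) / F t (t - y)" if "h \<le> y" "y \<le> \<delta>" for y
        using y[OF that] by (simp only: abs_diff_less_iff less_imp_le)
    qed
    show "F t (t - \<delta>) * (h / \<delta>) powr (d + e) \<le> F t (t - h)"
    proof (rule power_bound_of_log_derivative_le[OF h F D'])
      show "y * - d_snd F t (t - y) / F t (t - y) \<le> d + e" if "h \<le> y" "y \<le> \<delta>" for y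
        using y[OF that] by (simp only: abs_diff_less_iff less_imp_le)
    qed
  qed
  have "diagonal_kernel F \<delta> (F t0 (t0 - \<delta>) / \<delta> powr (d + e)) (d + e)"
  proof
    show "0 < F t0 (t0 - \<delta>) / \<delta> powr (d + e)" using pos[of "t0 - \<delta>" t0] \<delta> by simp
  next
    fix s r assume sr: "0 \<le> s" "s \<le> 1" "r < s" "s - r \<le> \<delta>"
    have F: "0 < F s r" using pos sr by auto
    show "d_snd F s r < 0"
    proof (rule ccontr)
      assume "\<not> d_snd F s r < 0"
      then have "0 \<le> (s - r) * d_snd F s r / F s r" using F sr by simp
      then show False using A[of "s - r" s] sr \<delta> e by auto
    qed
    show "0 < d_fst (d_snd F) s r"
    proof (rule ccontr)
      assume "\<not> 0 < d_fst (d_snd F) s r"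
      then have "(s - r)\<^sup>2 * d_fst (d_snd F) s r / F s r \<le> 0"
        using F sr by (simp add: divide_nonpos_pos mult_nonneg_nonpos)
      then show False using M[of "s - r" s] sr \<delta> d by (auto simp: algebra_simps)
    qed
    have "F t0 (t0 - \<delta>) / \<delta> powr (d + e) * (s - r) powr (d + e)
        = F t0 (t0 - \<delta>) * ((s - r) / \<delta>) powr (d + e)"
      using sr \<delta> by (simp add: powr_divide)
    also have "\<dots> \<le> F s (s - \<delta>) * ((s - r) / \<delta>) powr (d + e)"
      using t0(2)[of s] sr by (intro mult_right_mono) auto
    also have "\<dots> \<le> F s r"
      using lo[of s "s - r"] sr by auto
    finally show "F t0 (t0 - \<delta>) / \<delta> powr (d + e) * (s - r) powr (d + e) \<le> F s r" .
  next
    fix s r assume sr: "0 \<le> r" "r \<le> 1" "r < s" "s - r \<le> \<delta>"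
    have F: "0 < F s r" using pos sr by auto
    have "\<bar>(s - r) * d_fst F s r / F s r - d\<bar> < e" using B[of "s - r" r] sr \<delta> by auto
    then have *: "0 < (s - r) * d_fst F s r / F s r" "(s - r) * d_fst F s r / F s r \<le> 1"
      using e d by (auto simp: abs_less_iff)
    show "0 < d_fst F s r"
      using *(1) F sr(3) by (simp add: zero_less_divide_iff zero_less_mult_iff)
    show "d_fst F s r \<le> F s r / (s - r)"
      using *(2) F sr(3) by (simp add: field_simps)
  next
    fix s :: real assume s: "0 \<le> s" "s \<le> 1"
    \<comment> \<open>The upper power bound forces the value at the diagonal to be \<open>0\<close>.\<close>
    have "continuous_on {s - \<delta>..s} (F s)"
      by (rule continuous_on_kernel_section[OF cont]) simp
    then have "(F s \<longlongrightarrow> F s s) (at s within {s - \<delta>..s})"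
      using \<delta> by (simp add: continuous_on_def)
    then have "(F s \<longlongrightarrow> F s s) (at_left s)"
      using \<delta> by (simp add: at_within_Icc_at_left)
    moreover have "filterlim (\<lambda>h. s - h) (at_left s) (at_right 0)"
      by (auto simp: filterlim_at eventually_at_right_field intro!: tendsto_eq_intros exI[of _ 1])
    ultimately have lim: "((\<lambda>h. F s (s - h)) \<longlongrightarrow> F s s) (at_right 0)"
      by (rule filterlim_compose)
    have "((\<lambda>h. (h / \<delta>) powr (d - e)) \<longlongrightarrow> 0) (at_right 0)"
      using \<delta> e by (intro tendsto_powr2[THEN tendsto_eq_rhs] tendsto_eq_intros)
        (auto simp: eventually_at_right_field intro!: exI[of _ 1])
    then have z: "((\<lambda>h. F s (s - \<delta>) * (h / \<delta>) powr (d - e)) \<longlongrightarrow> 0) (at_right 0)"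
      by (rule tendsto_mult_right_zero)
    have ev: "\<forall>\<^sub>F h in at_right 0. F s (s - h) \<le> F s (s - \<delta>) * (h / \<delta>) powr (d - e)"
         "\<forall>\<^sub>F h in at_right 0. 0 \<le> F s (s - h)"
      unfolding eventually_at_right_field
      using \<delta> up[of s] s pos[of "s - _" s] by (force intro!: exI[of _ \<delta>])+
    have "((\<lambda>h. F s (s - h)) \<longlongrightarrow> 0) (at_right 0)"
      by (rule tendsto_sandwich[OF ev(2,1) tendsto_const z])
    then show "F s s = 0"
      using tendsto_unique[OF _ lim] by simp
  next
    show "isCont (d_snd F s) r" if "r < s" for s r
      using dss[OF that] by (rule DERIV_isCont)
  qed (use cont pos df ds dfs cm \<delta> e in auto)
  then show thesis by (rule that)
qed

section \<open>The pathwise modulus of continuity\<close>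

text \<open>The integral of the kernel against the path, after integration by parts. The boundary
  terms are absent because the kernel vanishes at the diagonal and the paths of interest start
  at \<open>0\<close>.\<close>

definition kernel_path :: "(real \<Rightarrow> real \<Rightarrow> real) \<Rightarrow> (real \<Rightarrow> real) \<Rightarrow> real \<Rightarrow> real" where
  "kernel_path F x t = - integral {0..t} (\<lambda>r. x r * d_snd F t r)"

context diagonal_kernel
begin

lemma has_integral_d_snd:
  assumes "a \<le> b" "b \<le> t"
  shows "(d_snd F t has_integral F t b - F t a) {a..b}"
proof (rule fundamental_theorem_of_calculus_interior[OF assms(1)])
  show "continuous_on {a..b} (F t)"
    by (rule continuous_on_kernel_section[OF cont assms(2)])
  show "(F t has_vector_derivative d_snd F t r) (at r)" if "r \<in> {a<..<b}" for r
    using deriv_snd[of r t] that assms by (simp add: has_real_derivative_iff_has_vector_derivative)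
qed

text \<open>Near the diagonal the derivative has a constant sign, so its absolute value inherits
  integrability from it; away from the diagonal it is continuous.\<close>

lemma abs_d_snd_integrable:
  assumes "0 \<le> t" "t \<le> 1"
  shows "(\<lambda>r. \<bar>d_snd F t r\<bar>) integrable_on {0..t}"
proof -
  let ?a = "max 0 (t - \<delta>)"
  have "(\<lambda>r. \<bar>d_snd F t r\<bar>) integrable_on {0..?a}"
  proof (cases "t \<le> \<delta>")
    case False
    then have "continuous_on {0..?a} (\<lambda>r. \<bar>d_snd F t r\<bar>)"
      using \<delta> cont_snd[of _ t] by (intro continuous_at_imp_continuous_on) (auto intro!: isCont_rabs)
    then show ?thesis by (rule integrable_continuous_real)
  next
    case True
    then show ?thesis
      using integrable_on_refl[of "\<lambda>r. \<bar>d_snd F t r\<bar>" 0] by (simp add: max_absorb1)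
  qed
  moreover have "((\<lambda>r. - d_snd F t r) has_integral - (F t t - F t ?a)) {?a..t}"
    using assms \<delta> by (intro has_integral_neg has_integral_d_snd) auto
  then have "((\<lambda>r. - d_snd F t r) has_integral - (F t t - F t ?a)) {?a<..<t}"
    using has_integral_Icc_iff_Ioo by blast
  then have "((\<lambda>r. \<bar>d_snd F t r\<bar>) has_integral - (F t t - F t ?a)) {?a<..<t}"
    by (rule has_integral_eq[rotated]) (use snd_neg[of t] assms in force)
  then have "(\<lambda>r. \<bar>d_snd F t r\<bar>) integrable_on {?a..t}"
    using has_integral_Icc_iff_Ioo by blast
  ultimately show ?thesis
    using assms \<delta> by (intro Henstock_Kurzweil_Integration.integrable_combine[where a = 0 and c = ?a and b = t]) auto
qed

lemma path_times_d_snd_integrable: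
  assumes "cadlag x" "0 \<le> t" "t \<le> 1"
  shows "(\<lambda>r. x r * d_snd F t r) integrable_on {0..t}"
proof (cases "t = 0")
  case False
  then show ?thesis
    using assms
    by (intro stieltjes_sums_tendsto(1)[where G = "F t"] abs_d_snd_integrable
          continuous_on_kernel_section[OF cont] deriv_snd) auto
next
  case True
  then show ?thesis using integrable_on_refl[of "\<lambda>r. x r * d_snd F t r" 0] by simp
qed

lemma continuous_on_kernel_section_fst:
  assumes "r \<le> a"
  shows "continuous_on {a..b} (\<lambda>u. F u r)"
proof -
  have "continuous_on ((\<lambda>u. (u, r)) ` {a..b}) (\<lambda>(s, r). F s r)"
    using assms by (intro continuous_on_subset[OF cont]) (auto simp: E_closed_def)
  then have "continuous_on {a..b} ((\<lambda>(s, r). F s r) \<circ> (\<lambda>u. (u, r)))"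
    by (intro continuous_on_compose continuous_intros)
  then show ?thesis by (simp add: o_def)
qed

lemma kernel_mono_fst:
  assumes "0 \<le> r" "r \<le> s" "s \<le> t" "t \<le> 1" "t - r \<le> \<delta>"
  shows "F s r \<le> F t r"
proof (rule DERIV_nonneg_imp_increasing_open[OF assms(3), of "\<lambda>u. F u r"])
  show "continuous_on {s..t} (\<lambda>u. F u r)"
    by (rule continuous_on_kernel_section_fst[OF assms(2)])
  show "\<exists>y. ((\<lambda>u. F u r) has_real_derivative y) (at u) \<and> 0 \<le> y" if "s < u" "u < t" for u
    using deriv_fst[of r u] fst_pos[of r u] assms that by (intro exI[of _ "d_fst F u r"]) auto
qed

text \<open>Decomposition of an increment. The path over \<open>(s, t)\<close> is weighted by \<open>- d_snd F t\<close>, of mass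
  \<open>F t s\<close>; the path over \<open>(a, s)\<close> is weighted by \<open>d_snd F t - d_snd F s\<close>, which is nonnegative
  because the mixed derivative is positive near the diagonal, and whose mass is
  \<open>F t s - (F t a - F s a)\<close>. So where the path stays within \<open>e\<close> of \<open>u\<close> after \<open>s\<close> and within
  \<open>e\<close> of \<open>v\<close> before \<open>s\<close>, the increment is \<open>(u - v) * F t s\<close> up to \<open>2 * e * F t s\<close> and up to
  contributions from times before \<open>a\<close>.\<close>

lemma kernel_path_increment:
  assumes x: "cadlag x" and a: "0 \<le> a" "a \<le> s" and st: "s < t" "t \<le> 1" "t - a \<le> \<delta>" and e: "0 \<le> e"
    and u: "\<And>r. s < r \<Longrightarrow> r < t \<Longrightarrow> \<bar>x r - u\<bar> \<le> e"
    and v: "\<And>r. a < r \<Longrightarrow> r < s \<Longrightarrow> \<bar>x r - v\<bar> \<le> e"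
  shows "\<bar>kernel_path F x t - kernel_path F x s - (u - v) * F t s - v * (F t a - F s a)
           + integral {0..a} (\<lambda>r. x r * (d_snd F t r - d_snd F s r))\<bar> \<le> 2 * e * F t s"
proof -
  let ?g = "\<lambda>r. x r * d_snd F t r" and ?f = "\<lambda>r. x r * d_snd F s r"
  have g: "?g integrable_on {0..t}" and f: "?f integrable_on {0..s}"
    using path_times_d_snd_integrable[OF x] a st by auto
  have gs: "?g integrable_on {b..b'}" if "0 \<le> b" "b' \<le> t" for b b'
    using that by (intro integrable_subinterval_real[OF g]) auto
  have fs: "?f integrable_on {b..b'}" if "0 \<le> b" "b' \<le> s" for b b'
    using that by (intro integrable_subinterval_real[OF f]) auto
  have diff: "x r * (d_snd F t r - d_snd F s r) = ?g r - ?f r" for r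
    by (simp add: algebra_simps)
  define Is where "Is = integral {s..t} ?g"
  define Ia where "Ia = integral {a..s} (\<lambda>r. x r * (d_snd F t r - d_snd F s r))"
  have ts: "integral {0..t} ?g = integral {0..a} ?g + integral {a..s} ?g + Is"
    unfolding Is_def
    using Henstock_Kurzweil_Integration.integral_combine[where a = 0 and c = a and b = s and f = ?g]
      Henstock_Kurzweil_Integration.integral_combine[where a = 0 and c = s and b = t and f = ?g] gs g a st by auto
  have ss: "integral {0..s} ?f = integral {0..a} ?f + integral {a..s} ?f"
    using Henstock_Kurzweil_Integration.integral_combine[where a = 0 and c = a and b = s and f = ?f] f a by auto
  have split: "kernel_path F x t - kernel_path F x s
        + integral {0..a} (\<lambda>r. x r * (d_snd F t r - d_snd F s r)) = - Ia - Is"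
    unfolding kernel_path_def Ia_def diff ts ss using a st
    by (subst (1 2) integral_diff) (auto intro: gs fs)
  have dt: "(d_snd F t has_integral - F t s) {s..t}"
    using has_integral_d_snd[of s t t] diag[of t] a st by auto
  have "\<bar>integral {s..t} (\<lambda>r. (x r - u) * d_snd F t r)\<bar> \<le> e * F t s"
  proof (rule abs_integral_le)
    show "(\<lambda>r. (x r - u) * d_snd F t r) integrable_on {s..t}"
      unfolding left_diff_distrib using gs[of s t] dt a st
      by (intro integrable_diff integrable_on_mult_right) auto
    show "((\<lambda>r. e * - d_snd F t r) has_integral e * F t s) {s..t}"
      using has_integral_mult_right[OF has_integral_neg[OF dt], of e] by simp
    show "\<bar>(x r - u) * d_snd F t r\<bar> \<le> e * - d_snd F t r" if "s < r" "r < t" for r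
      using snd_neg[of t r] u[OF that] a st that by (simp add: abs_mult mult_right_mono)
  qed
  moreover have "integral {s..t} (\<lambda>r. (x r - u) * d_snd F t r) = Is + u * F t s"
    unfolding left_diff_distrib Is_def using gs[of s t] dt a st
    by (subst integral_diff)
       (auto simp: integral_unique intro!: integrable_on_mult_right dest: has_integral_integrable)
  ultimately have 1: "\<bar>- Is - u * F t s\<bar> \<le> e * F t s" by linarith
  have dl: "((\<lambda>r. d_snd F t r - d_snd F s r) has_integral F t s - (F t a - F s a)) {a..s}"
    using has_integral_diff[OF has_integral_d_snd[of a s t] has_integral_d_snd[of a s s]]
      diag[of s] a st by (auto simp: algebra_simps)
  have xl: "(\<lambda>r. x r * (d_snd F t r - d_snd F s r)) integrable_on {a..s}"
    unfolding diff using gs[of a s] fs[of a s] a st by (intro integrable_diff) auto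
  have vl: "((\<lambda>r. v * (d_snd F t r - d_snd F s r)) has_integral v * (F t s - (F t a - F s a))) {a..s}"
    by (rule has_integral_mult_right[OF dl])
  have "\<bar>integral {a..s} (\<lambda>r. (x r - v) * (d_snd F t r - d_snd F s r))\<bar>
      \<le> e * (F t s - (F t a - F s a))"
  proof (rule abs_integral_le)
    show "(\<lambda>r. (x r - v) * (d_snd F t r - d_snd F s r)) integrable_on {a..s}"
      unfolding left_diff_distrib[of "x _"]
      by (rule integrable_diff[OF xl has_integral_integrable[OF vl]])
    show "((\<lambda>r. e * (d_snd F t r - d_snd F s r)) has_integral e * (F t s - (F t a - F s a))) {a..s}"
      by (rule has_integral_mult_right[OF dl])
    fix r assume r: "a < r" "r < s"
    have "d_snd F s r \<le> d_snd F t r"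
    proof (rule DERIV_nonneg_imp_nondecreasing[of s t "\<lambda>w. d_snd F w r"])
      show "\<exists>y. ((\<lambda>w. d_snd F w r) has_real_derivative y) (at w) \<and> 0 \<le> y" if "s \<le> w" "w \<le> t" for w
        using deriv_mixed[of r w] mixed_pos[of w r] a st r that
        by (intro exI[of _ "d_fst (d_snd F) w r"]) auto
    qed (use st in simp)
    then show "\<bar>(x r - v) * (d_snd F t r - d_snd F s r)\<bar> \<le> e * (d_snd F t r - d_snd F s r)"
      using v[OF r] by (simp add: abs_mult mult_right_mono)
  qed
  moreover have "integral {a..s} (\<lambda>r. (x r - v) * (d_snd F t r - d_snd F s r))
      = Ia - v * (F t s - (F t a - F s a))"
    unfolding left_diff_distrib[of "x _"] Ia_def
    using integral_diff[OF xl has_integral_integrable[OF vl]] integral_unique[OF vl] by simp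
  moreover have "e * (F t s - (F t a - F s a)) \<le> e * F t s"
    using kernel_mono_fst[of a s t] a st e by (intro mult_left_mono) auto
  ultimately have 2: "\<bar>- Ia + v * (F t s - (F t a - F s a))\<bar> \<le> e * F t s" by linarith
  have "kernel_path F x t - kernel_path F x s - (u - v) * F t s - v * (F t a - F s a)
           + integral {0..a} (\<lambda>r. x r * (d_snd F t r - d_snd F s r))
      = (- Is - u * F t s) + (- Ia + v * (F t s - (F t a - F s a)))"
    using split by (simp add: algebra_simps)
  with 1 2 show ?thesis by linarith
qed

lemma d_snd_lipschitz_off_diagonal:
  assumes "0 < \<eta>"
  obtains C where "0 \<le> C"
    and "\<And>r s t. 0 \<le> r \<Longrightarrow> r + \<eta> \<le> s \<Longrightarrow> s < t \<Longrightarrow> t \<le> 1 \<Longrightarrow> \<bar>d_snd F t r - d_snd F s r\<bar> \<le> C * (t - s)"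
proof -
  define S where "S = ({0..1} \<times> {0..1}) \<inter> {z. snd z + \<eta> \<le> (fst z :: real)}"
  have "compact S"
    unfolding S_def
    by (intro compact_Int_closed compact_Times compact_Icc closed_Collect_le continuous_intros)
  moreover have "continuous_on S (\<lambda>(s, r). d_fst (d_snd F) s r)"
    using assms by (intro continuous_on_subset[OF cont_mixed]) (auto simp: S_def E_open_def)
  ultimately have "bounded ((\<lambda>(s, r). d_fst (d_snd F) s r) ` S)"
    by (intro compact_imp_bounded compact_continuous_image)
  then obtain C where C: "0 < C" "\<And>z. z \<in> S \<Longrightarrow> \<bar>(\<lambda>(s, r). d_fst (d_snd F) s r) z\<bar> \<le> C"
    unfolding bounded_pos real_norm_def by blast
  show thesis
  proof (rule that[of C])
    fix r s t assume rst: "0 \<le> r" "r + \<eta> \<le> s" "s < t" "t \<le> 1"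
    obtain z where z: "s < z" "z < t" "d_snd F t r - d_snd F s r = (t - s) * d_fst (d_snd F) z r"
      using MVT2[of s t "\<lambda>u. d_snd F u r" "\<lambda>u. d_fst (d_snd F) u r"] deriv_mixed[of r] rst assms
      by auto
    have "\<bar>d_fst (d_snd F) z r\<bar> \<le> C"
      using C(2)[of "(z, r)"] rst z assms by (auto simp: S_def)
    then show "\<bar>d_snd F t r - d_snd F s r\<bar> \<le> C * (t - s)"
      unfolding z(3) using rst by (simp add: abs_mult mult.commute)
  qed (use C in simp)
qed

lemma kernel_bounded:
  obtains K where "0 \<le> K" "\<And>s r. 0 \<le> r \<Longrightarrow> r \<le> s \<Longrightarrow> s \<le> 1 \<Longrightarrow> F s r \<le> K"
proof -
  define S where "S = ({0..1} \<times> {0..1}) \<inter> {z. snd z \<le> (fst z :: real)}"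
  have "compact S"
    unfolding S_def
    by (intro compact_Int_closed compact_Times compact_Icc closed_Collect_le continuous_intros)
  moreover have "continuous_on S (\<lambda>(s, r). F s r)"
    by (intro continuous_on_subset[OF cont]) (auto simp: S_def E_closed_def)
  ultimately have "bounded ((\<lambda>(s, r). F s r) ` S)"
    by (intro compact_imp_bounded compact_continuous_image)
  then obtain C where C: "0 < C" "\<And>z. z \<in> S \<Longrightarrow> \<bar>(\<lambda>(s, r). F s r) z\<bar> \<le> C"
    unfolding bounded_pos real_norm_def by blast
  show thesis
  proof (rule that[of C])
    fix r s assume "0 \<le> r" "r \<le> s" "s \<le> (1::real)"
    then show "F s r \<le> C" using C(2)[of "(s, r)"] by (auto simp: S_def)
  qed (use C in simp)
qed

text \<open>With \<open>a = s - \<eta>\<close> for a fixed \<open>\<eta>\<close>, what lies before \<open>a\<close> changes by \<open>O(t - s)\<close>, which is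
  \<open>o(F t s)\<close> because \<open>F t s\<close> is at least \<open>c * (t - s) powr q\<close> with \<open>q < 1\<close>.\<close>

lemma kernel_path_increment_estimate:
  assumes x: "cadlag x" and \<eta>: "0 < \<eta>" "2 * \<eta> \<le> \<delta>" and V: "0 \<le> V" and \<epsilon>: "0 < \<epsilon>"
  obtains h\<^sub>0 where "0 < h\<^sub>0" "h\<^sub>0 \<le> \<eta>"
    and "\<And>s t u v e. \<eta> \<le> s \<Longrightarrow> s < t \<Longrightarrow> t \<le> 1 \<Longrightarrow> t - s \<le> h\<^sub>0 \<Longrightarrow> \<bar>v\<bar> \<le> V \<Longrightarrow> 0 \<le> e \<Longrightarrow>
      (\<And>r. s < r \<Longrightarrow> r < t \<Longrightarrow> \<bar>x r - u\<bar> \<le> e) \<Longrightarrow>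
      (\<And>r. s - \<eta> < r \<Longrightarrow> r < s \<Longrightarrow> \<bar>x r - v\<bar> \<le> e) \<Longrightarrow>
      \<bar>kernel_path F x t - kernel_path F x s - (u - v) * F t s\<bar> \<le> (2 * e + \<epsilon>) * F t s"
proof -
  obtain B where B: "0 \<le> B" "\<And>r. 0 \<le> r \<Longrightarrow> r \<le> 1 \<Longrightarrow> \<bar>x r\<bar> \<le> B"
    using cadlag_bounded[OF x] by blast
  obtain C where C: "0 \<le> C" "\<And>r s t. 0 \<le> r \<Longrightarrow> r + \<eta> \<le> s \<Longrightarrow> s < t \<Longrightarrow> t \<le> 1 \<Longrightarrow>
      \<bar>d_snd F t r - d_snd F s r\<bar> \<le> C * (t - s)"
    using d_snd_lipschitz_off_diagonal[OF \<eta>(1)] by blast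
  obtain K where K: "0 \<le> K" "\<And>s r. 0 \<le> r \<Longrightarrow> r \<le> s \<Longrightarrow> s \<le> 1 \<Longrightarrow> F s r \<le> K"
    using kernel_bounded by blast
  define A where "A = V * (K / \<eta>) + B * C"
  have A: "0 \<le> A" using V K(1) \<eta>(1) B(1) C(1) by (simp add: A_def)
  \<comment> \<open>For \<open>t - s \<le> h\<^sub>0\<close> one has \<open>A * (t - s) \<le> \<epsilon> * c * (t - s) powr q\<close>; the summand \<open>1\<close> only avoids
    dividing by \<open>0\<close>.\<close>
  define h\<^sub>0 where "h\<^sub>0 = min \<eta> ((\<epsilon> * c / (A + 1)) powr (1 / (1 - q)))"
  have h0: "0 < h\<^sub>0" "h\<^sub>0 \<le> \<eta>"
    using \<eta>(1) \<epsilon> c A by (auto simp: h\<^sub>0_def)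
  have small: "A * (t - s) \<le> \<epsilon> * F t s" if "0 \<le> s" "s < t" "t \<le> 1" "t - s \<le> h\<^sub>0" for s t
  proof -
    have ts: "0 < t - s" using that by simp
    have "(t - s) powr (1 - q) \<le> ((\<epsilon> * c / (A + 1)) powr (1 / (1 - q))) powr (1 - q)"
      using that q ts by (intro powr_mono2) (auto simp: h\<^sub>0_def)
    also have "\<dots> = \<epsilon> * c / (A + 1)"
      using q \<epsilon> c A by (simp add: powr_powr)
    finally have "(A + 1) * (t - s) powr (1 - q) \<le> \<epsilon> * c"
      using A by (simp add: field_simps)
    then have "A * (t - s) powr (1 - q) \<le> \<epsilon> * c"
      by (simp add: algebra_simps) (smt (verit) powr_ge_zero)
    then have "A * (t - s) powr (1 - q) * (t - s) powr q \<le> \<epsilon> * c * (t - s) powr q"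
      by (intro mult_right_mono) auto
    also have "(A * (t - s) powr (1 - q)) * (t - s) powr q = A * (t - s)"
      using ts by (simp add: powr_add[symmetric])
    also have "\<epsilon> * c * (t - s) powr q \<le> \<epsilon> * F t s"
      using lower[of t s] that h0 \<eta> \<epsilon> by (simp add: mult.assoc)
    finally show ?thesis .
  qed
  show thesis
  proof (rule that[OF h0])
    fix s t u v e
    assume s: "\<eta> \<le> s" and t: "s < t" "t \<le> 1" "t - s \<le> h\<^sub>0" and v: "\<bar>v\<bar> \<le> V" and e: "0 \<le> e"
      and cu: "\<And>r. s < r \<Longrightarrow> r < t \<Longrightarrow> \<bar>x r - u\<bar> \<le> e"
      and cv: "\<And>r. s - \<eta> < r \<Longrightarrow> r < s \<Longrightarrow> \<bar>x r - v\<bar> \<le> e"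
    define a where "a = s - \<eta>"
    have a: "0 \<le> a" "a < s" "t - a \<le> \<delta>" "a + \<eta> \<le> s" using s t h0 \<eta> by (auto simp: a_def)
    define R where "R = integral {0..a} (\<lambda>r. x r * (d_snd F t r - d_snd F s r))"
    have main: "\<bar>kernel_path F x t - kernel_path F x s - (u - v) * F t s - v * (F t a - F s a) + R\<bar>
        \<le> 2 * e * F t s"
      unfolding R_def by (rule kernel_path_increment[OF x _ _ t(1,2) _ e cu])
        (use a cv in \<open>auto simp: a_def\<close>)
    have R: "\<bar>R\<bar> \<le> B * C * (t - s)"
    proof -
      have "\<bar>R\<bar> \<le> (a - 0) * (B * (C * (t - s)))"
        unfolding R_def
      proof (rule abs_integral_le)
        have "(\<lambda>r. x r * d_snd F t r) integrable_on {0..a}" "(\<lambda>r. x r * d_snd F s r) integrable_on {0..a}"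
          using path_times_d_snd_integrable[OF x, of t] path_times_d_snd_integrable[OF x, of s] a t
          by (auto intro: integrable_subinterval_real)
        then show "(\<lambda>r. x r * (d_snd F t r - d_snd F s r)) integrable_on {0..a}"
          unfolding right_diff_distrib by (rule integrable_diff)
        show "((\<lambda>r. B * (C * (t - s))) has_integral (a - 0) * (B * (C * (t - s)))) {0..a}"
          using has_integral_const_real[of "B * (C * (t - s))" 0 a] a by simp
        show "\<bar>x r * (d_snd F t r - d_snd F s r)\<bar> \<le> B * (C * (t - s))" if "0 < r" "r < a" for r
          unfolding abs_mult using B that a t C(1) by (intro mult_mono C(2)) auto
      qed
      also have "\<dots> \<le> 1 * (B * (C * (t - s)))"
        using a t B C by (intro mult_right_mono) auto
      finally show ?thesis by (simp add: mult.assoc)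
    qed
    have "\<bar>v * (F t a - F s a)\<bar> \<le> V * (K / \<eta> * (t - s))"
      unfolding abs_mult
    proof (rule mult_mono[OF v _ V])
      obtain z where z: "s < z" "z < t" "F t a - F s a = (t - s) * d_fst F z a"
        using MVT2[of s t "\<lambda>u. F u a" "\<lambda>u. d_fst F u a"] deriv_fst[of a] a t by auto
      have "d_fst F z a \<le> F z a / (z - a)"
        using fst_le[of a z] a t z by auto
      also have "\<dots> \<le> K / \<eta>"
        using K(2)[of a z] K(1) a t z \<eta> by (intro frac_le) auto
      finally have "(t - s) * d_fst F z a \<le> (t - s) * (K / \<eta>)"
        using t by (intro mult_left_mono) auto
      then show "\<bar>F t a - F s a\<bar> \<le> K / \<eta> * (t - s)"
        unfolding z(3) abs_mult using t fst_pos[of a z] a z by (simp add: mult.commute)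
    qed simp
    with R have "\<bar>v * (F t a - F s a)\<bar> + \<bar>R\<bar> \<le> A * (t - s)"
      by (simp add: A_def algebra_simps)
    also have "\<dots> \<le> \<epsilon> * F t s"
      using small[of s t] s t \<eta> by simp
    finally show "\<bar>kernel_path F x t - kernel_path F x s - (u - v) * F t s\<bar> \<le> (2 * e + \<epsilon>) * F t s"
      using main unfolding distrib_right by linarith
  qed
qed


text \<open>Both weights have mass close to \<open>F t s\<close>, so the increment is essentially \<open>F t s\<close> times the
  difference of two weighted means of the path over one short interval, hence at most \<open>F t s\<close>
  times the oscillation there, and that exceeds the largest jump by little.\<close>

lemma kernel_path_modulus_upper:
  assumes x: "cadlag x" "x 0 = 0" and \<epsilon>: "0 < \<epsilon>" and J0: "0 \<le> J"
    and J: "\<And>s. 0 \<le> s \<Longrightarrow> s < 1 \<Longrightarrow> \<bar>jump x s\<bar> \<le> J"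
  obtains h\<^sub>0 where "0 < h\<^sub>0"
    and "\<And>s t. 0 < s \<Longrightarrow> s < t \<Longrightarrow> t < 1 \<Longrightarrow> t - s \<le> h\<^sub>0 \<Longrightarrow>
      \<bar>kernel_path F x t - kernel_path F x s\<bar> \<le> (J + \<epsilon>) * F t s"
proof -
  define D where "D = J + \<epsilon> / 2"
  have D: "0 < D" using J0 \<epsilon> by (simp add: D_def)
  obtain B where B: "0 \<le> B" "\<And>r. 0 \<le> r \<Longrightarrow> r \<le> 1 \<Longrightarrow> \<bar>x r\<bar> \<le> B"
    using cadlag_bounded[OF x(1)] by blast
  obtain \<eta>1 where \<eta>1: "0 < \<eta>1"
    and osc: "\<And>u v. 0 \<le> u \<Longrightarrow> u < 1 \<Longrightarrow> 0 \<le> v \<Longrightarrow> v < 1 \<Longrightarrow> \<bar>u - v\<bar> < \<eta>1 \<Longrightarrow> \<bar>x u - x v\<bar> \<le> D"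
    using cadlag_oscillation[OF x(1), of "\<epsilon> / 2" 1 J] J \<epsilon> unfolding D_def by (metis half_gt_zero)
  obtain \<eta>2 where \<eta>2: "0 < \<eta>2" and near0: "\<And>u. 0 \<le> u \<Longrightarrow> u < \<eta>2 \<Longrightarrow> \<bar>x u\<bar> < \<epsilon> / 2"
    using cadlag_local[OF x(1), of 0 "\<epsilon> / 2"] \<epsilon> x(2) by auto
  define \<eta> where "\<eta> = min \<delta> (min \<eta>1 \<eta>2) / 2"
  have \<eta>: "0 < \<eta>" "2 * \<eta> \<le> \<delta>" "2 * \<eta> \<le> \<eta>1" "2 * \<eta> \<le> \<eta>2"
    using \<eta>1 \<eta>2 \<delta> by (auto simp: \<eta>_def)
  obtain h where h: "0 < h" "h \<le> \<eta>"
    and est: "\<And>s t u v e. \<eta> \<le> s \<Longrightarrow> s < t \<Longrightarrow> t \<le> 1 \<Longrightarrow> t - s \<le> h \<Longrightarrow> \<bar>v\<bar> \<le> B + D \<Longrightarrow> 0 \<le> e \<Longrightarrow>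
      (\<And>r. s < r \<Longrightarrow> r < t \<Longrightarrow> \<bar>x r - u\<bar> \<le> e) \<Longrightarrow>
      (\<And>r. s - \<eta> < r \<Longrightarrow> r < s \<Longrightarrow> \<bar>x r - v\<bar> \<le> e) \<Longrightarrow>
      \<bar>kernel_path F x t - kernel_path F x s - (u - v) * F t s\<bar> \<le> (2 * e + \<epsilon> / 2) * F t s"
    using kernel_path_increment_estimate[OF x(1) \<eta>(1,2), of "B + D" "\<epsilon> / 2"] B(1) D \<epsilon>
    by (metis add_nonneg_nonneg half_gt_zero less_imp_le)
  show thesis
  proof (rule that[OF h(1)])
    fix s t :: real assume st: "0 < s" "s < t" "t < 1" "t - s \<le> h"
    have F: "0 < F t s" using pos st by simp
    show "\<bar>kernel_path F x t - kernel_path F x s\<bar> \<le> (J + \<epsilon>) * F t s"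
    proof (cases "\<eta> \<le> s")
      case True
      \<comment> \<open>The path stays in an interval of length \<open>D\<close> over \<open>(s - \<eta>, t)\<close>; both weighted means are
        compared with its midpoint \<open>v\<close>.\<close>
      define S where "S = x ` {s - \<eta><..<t}"
      define v where "v = Inf S + D / 2"
      have lo: "- B \<le> y" "y \<le> B" if y: "y \<in> S" for y
      proof -
        obtain r where "y = x r" "s - \<eta> < r" "r < t" using y by (auto simp: S_def)
        then have "\<bar>y\<bar> \<le> B" using B(2)[of r] True st by simp
        then show "- B \<le> y" "y \<le> B" by auto
      qed
      have ne: "x s \<in> S" using st \<eta> by (auto simp: S_def)
      have bdd: "bdd_below S" using lo by (auto simp: bdd_below_def)
      have "- B \<le> Inf S" using ne lo by (intro cInf_greatest) auto
      moreover have "Inf S \<le> B" using cInf_lower[OF ne bdd] lo(2)[OF ne] by simp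
      ultimately have v: "\<bar>v\<bar> \<le> B + D" using D by (auto simp: v_def)
      have close: "\<bar>x r - v\<bar> \<le> D / 2" if r: "s - \<eta> < r" "r < t" for r
      proof -
        have "Inf S \<le> x r" using r bdd by (intro cInf_lower) (auto simp: S_def)
        moreover have "x r - D \<le> Inf S"
        proof (rule cInf_greatest)
          fix y assume "y \<in> S"
          then obtain r' where r': "y = x r'" "s - \<eta> < r'" "r' < t" by (auto simp: S_def)
          have "\<bar>x r - x r'\<bar> \<le> D" using r r' True st h \<eta> by (intro osc) auto
          then show "x r - D \<le> y" using r' by linarith
        qed (use ne in auto)
        ultimately show ?thesis by (simp add: v_def abs_le_iff field_simps)
      qed
      have "\<bar>kernel_path F x t - kernel_path F x s - (v - v) * F t s\<bar>
          \<le> (2 * (D / 2) + \<epsilon> / 2) * F t s"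
        using True st v D \<eta> by (intro est close) auto
      moreover have "2 * (D / 2) + \<epsilon> / 2 = J + \<epsilon>" by (simp add: D_def field_simps)
      ultimately show ?thesis by simp
    next
      case False
      \<comment> \<open>Near \<open>0\<close> the path is small, so the whole past can be taken as the interval before \<open>s\<close>.\<close>
      have small: "\<bar>x r - 0\<bar> \<le> \<epsilon> / 2" if "0 < r" "r < t" for r
        using near0[of r] that False st h \<eta> by auto
      have "\<bar>kernel_path F x t - kernel_path F x s - (0 - 0) * F t s - 0 * (F t 0 - F s 0)
           + integral {0..0} (\<lambda>r. x r * (d_snd F t r - d_snd F s r))\<bar> \<le> 2 * (\<epsilon> / 2) * F t s"
        using False st h \<eta> \<epsilon> by (intro kernel_path_increment small x(1)) auto
      then have "\<bar>kernel_path F x t - kernel_path F x s\<bar> \<le> \<epsilon> * F t s" by simp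
      also have "\<dots> \<le> (J + \<epsilon>) * F t s" using F J0 by (intro mult_right_mono) auto
      finally show ?thesis .
    qed
  qed
qed

text \<open>Placing \<open>s\<close> exactly at a time \<open>p\<close> makes the two weighted means converge to the value and to
  the left limit of the path at \<open>p\<close>, so the upper bound is attained in the limit.\<close>

lemma kernel_path_increment_after_jump:
  assumes x: "cadlag x" and p: "0 < p" and \<epsilon>: "0 < \<epsilon>"
  obtains h\<^sub>0 where "0 < h\<^sub>0"
    and "\<And>t. p < t \<Longrightarrow> t \<le> 1 \<Longrightarrow> t - p \<le> h\<^sub>0 \<Longrightarrow>
      \<bar>kernel_path F x t - kernel_path F x p - jump x p * F t p\<bar> \<le> \<epsilon> * F t p"
proof -
  obtain \<gamma> where \<gamma>: "0 < \<gamma>"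
    and R: "\<And>u. p \<le> u \<Longrightarrow> u < p + \<gamma> \<Longrightarrow> \<bar>x u - x p\<bar> < \<epsilon> / 4"
    and L: "\<And>u. 0 \<le> u \<Longrightarrow> p - \<gamma> < u \<Longrightarrow> u < p \<Longrightarrow> \<bar>x u - (x p - jump x p)\<bar> < \<epsilon> / 4"
    using cadlag_local[OF x, of p "\<epsilon> / 4"] p \<epsilon> by auto
  define \<eta> where "\<eta> = min \<gamma> (min p (\<delta> / 2))"
  have \<eta>: "0 < \<eta>" "2 * \<eta> \<le> \<delta>" "\<eta> \<le> p" "\<eta> \<le> \<gamma>" using \<gamma> p \<delta> by (auto simp: \<eta>_def)
  obtain h where h: "0 < h" "h \<le> \<eta>"
    and est: "\<And>s t u v e. \<eta> \<le> s \<Longrightarrow> s < t \<Longrightarrow> t \<le> 1 \<Longrightarrow> t - s \<le> h \<Longrightarrow>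
      \<bar>v\<bar> \<le> \<bar>x p - jump x p\<bar> \<Longrightarrow> 0 \<le> e \<Longrightarrow>
      (\<And>r. s < r \<Longrightarrow> r < t \<Longrightarrow> \<bar>x r - u\<bar> \<le> e) \<Longrightarrow>
      (\<And>r. s - \<eta> < r \<Longrightarrow> r < s \<Longrightarrow> \<bar>x r - v\<bar> \<le> e) \<Longrightarrow>
      \<bar>kernel_path F x t - kernel_path F x s - (u - v) * F t s\<bar> \<le> (2 * e + \<epsilon> / 2) * F t s"
    using kernel_path_increment_estimate[OF x \<eta>(1,2), of "\<bar>x p - jump x p\<bar>" "\<epsilon> / 2"] \<epsilon>
    by (metis abs_ge_zero half_gt_zero)
  show thesis
  proof (rule that[OF h(1)])
    fix t assume t: "p < t" "t \<le> 1" "t - p \<le> h"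
    have "\<bar>kernel_path F x t - kernel_path F x p - (x p - (x p - jump x p)) * F t p\<bar>
        \<le> (2 * (\<epsilon> / 4) + \<epsilon> / 2) * F t p"
    proof (rule est)
      show "\<bar>x r - x p\<bar> \<le> \<epsilon> / 4" if "p < r" "r < t" for r
        using R[of r] that t h \<eta> by auto
      show "\<bar>x r - (x p - jump x p)\<bar> \<le> \<epsilon> / 4" if "p - \<eta> < r" "r < p" for r
        using L[of r] that \<eta> by auto
    qed (use t \<eta> \<epsilon> in auto)
    then show "\<bar>kernel_path F x t - kernel_path F x p - jump x p * F t p\<bar> \<le> \<epsilon> * F t p"
      by simp
  qed
qed

lemma jump_le_normalized_modulus:
  assumes x: "cadlag x" and p: "0 < p" "p < 1" and h: "0 < h"
  shows "ennreal \<bar>jump x p\<bar> \<le> normalized_modulus F (kernel_path F x) h"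
proof (rule ennreal_le_epsilon)
  fix \<epsilon> :: real assume \<epsilon>: "0 < \<epsilon>"
  obtain h\<^sub>0 where h0: "0 < h\<^sub>0" and inc: "\<And>t. p < t \<Longrightarrow> t \<le> 1 \<Longrightarrow> t - p \<le> h\<^sub>0 \<Longrightarrow>
      \<bar>kernel_path F x t - kernel_path F x p - jump x p * F t p\<bar> \<le> \<epsilon> * F t p"
    using kernel_path_increment_after_jump[OF x p(1) \<epsilon>] by blast
  define t where "t = p + min h (min h\<^sub>0 ((1 - p) / 2))"
  have t: "p < t" "t < 1" "t - p \<le> h" "t - p \<le> h\<^sub>0" using p h h0 by (auto simp: t_def min_def field_simps)
  have F: "0 < F t p" using pos t by simp
  have "\<bar>jump x p * F t p\<bar> \<le> \<bar>kernel_path F x t - kernel_path F x p\<bar> + \<epsilon> * F t p"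
    using inc[of t] t by auto
  then have "\<bar>jump x p\<bar> \<le> \<bar>kernel_path F x t - kernel_path F x p\<bar> / F t p + \<epsilon>"
    using F by (simp add: abs_mult field_simps)
  then have "ennreal \<bar>jump x p\<bar>
      \<le> ennreal (\<bar>kernel_path F x t - kernel_path F x p\<bar> / F t p) + ennreal \<epsilon>"
    using F \<epsilon> by (simp flip: ennreal_plus add: ennreal_leI)
  also have "ennreal (\<bar>kernel_path F x t - kernel_path F x p\<bar> / F t p)
      \<le> normalized_modulus F (kernel_path F x) h"
    unfolding normalized_modulus_def using p t by (intro SUP_upper2[of "(p, t)"]) auto
  finally show "ennreal \<bar>jump x p\<bar> \<le> normalized_modulus F (kernel_path F x) h + ennreal \<epsilon>"
    by (simp add: add_right_mono)
qed

lemma kernel_path_modulus_tendsto: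
  assumes x: "cadlag x" "x 0 = 0"
  shows "(normalized_modulus F (kernel_path F x) \<longlongrightarrow> (SUP s\<in>{0..<1}. ennreal \<bar>jump x s\<bar>))
           (at_right 0)"
proof (rule order_tendstoI)
  let ?J = "SUP s\<in>{0..<1}. ennreal \<bar>jump x s\<bar>" and ?m = "normalized_modulus F (kernel_path F x)"
  have ge: "?J \<le> ?m h" if "0 < h" for h
  proof (rule SUP_least)
    fix s :: real assume "s \<in> {0..<1}"
    then show "ennreal \<bar>jump x s\<bar> \<le> ?m h"
      using jump_le_normalized_modulus[OF x(1) _ _ that, of s] x(2)
      by (cases "s = 0") (auto simp: jump_def)
  qed
  fix a :: ennreal
  show "\<forall>\<^sub>F h in at_right 0. a < ?m h" if "a < ?J"
    unfolding eventually_at_right_field using less_le_trans[OF that ge] zero_less_one by blast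
  show "\<forall>\<^sub>F h in at_right 0. ?m h < a" if Ja: "?J < a"
  proof -
    obtain b where b: "?J < b" "b < a" using dense[OF Ja] by blast
    then have "?J < top" "b < top" by (auto simp: less_top dest: less_le_trans[OF _ top_greatest])
    then obtain J b' where J: "?J = ennreal J" "0 \<le> J" and b': "b = ennreal b'" "0 \<le> b'"
      by (metis ennreal_cases less_irrefl)
    have "J < b'" using b(1) J b' by (simp add: ennreal_less_iff)
    have le: "\<bar>jump x s\<bar> \<le> J" if "0 \<le> s" "s < 1" for s
    proof -
      have "ennreal \<bar>jump x s\<bar> \<le> ennreal J" unfolding J(1)[symmetric] using that by (intro SUP_upper) auto
      then show ?thesis using J(2) by simp
    qed
    obtain h\<^sub>0 where h0: "0 < h\<^sub>0" "\<And>s t. 0 < s \<Longrightarrow> s < t \<Longrightarrow> t < 1 \<Longrightarrow> t - s \<le> h\<^sub>0 \<Longrightarrow>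
        \<bar>kernel_path F x t - kernel_path F x s\<bar> \<le> (J + (b' - J)) * F t s"
      using kernel_path_modulus_upper[OF x _ J(2) le, of "b' - J"] \<open>J < b'\<close> by auto
    have "?m h \<le> b" if "h < h\<^sub>0" for h
      unfolding normalized_modulus_def
    proof (rule SUP_least, clarify)
      fix s t assume st: "0 < s" "s < t" "t < 1" "\<bar>t - s\<bar> \<le> h"
      then have "\<bar>kernel_path F x t - kernel_path F x s\<bar> / F t s \<le> b'"
        using h0(2)[of s t] pos[of s t] that by (simp add: field_simps)
      then show "ennreal (\<bar>kernel_path F x t - kernel_path F x s\<bar> / F t s) \<le> b"
        unfolding b' by (rule ennreal_leI)
    qed
    then show ?thesis
      unfolding eventually_at_right_field using h0(1) le_less_trans[OF _ b(2)] by blast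
  qed
qed

text \<open>This allows the almost sure equality of the process with its pathwise version, which is
  obtained for one time at a time, to be extended from rational times to all times.\<close>

lemma kernel_path_right_continuous:
  assumes x: "cadlag x" "x 0 = 0" and s: "0 < s" "s < 1"
  shows "(kernel_path F x \<longlongrightarrow> kernel_path F x s) (at_right s)"
proof -
  obtain B where B: "0 \<le> B" "\<And>r. 0 \<le> r \<Longrightarrow> r \<le> 1 \<Longrightarrow> \<bar>jump x r\<bar> \<le> B"
    using cadlag_jump_bounded[OF x(1)] by blast
  obtain h where h: "0 < h" "\<And>s t. 0 < s \<Longrightarrow> s < t \<Longrightarrow> t < 1 \<Longrightarrow> t - s \<le> h \<Longrightarrow>
      \<bar>kernel_path F x t - kernel_path F x s\<bar> \<le> (B + 1) * F t s"
    using kernel_path_modulus_upper[OF x zero_less_one B(1)] B(2) by auto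
  have "continuous_on {s..1} (\<lambda>u. F u s)"
    by (rule continuous_on_kernel_section_fst) simp
  then have "((\<lambda>u. F u s) \<longlongrightarrow> F s s) (at_right s)"
    using s continuous_on_Icc_at_rightD[of s 1 "\<lambda>u. F u s"] by simp
  then have "((\<lambda>u. (B + 1) * F u s) \<longlongrightarrow> (B + 1) * 0) (at_right s)"
    using diag[of s] s by (intro tendsto_intros) simp
  then have lim: "((\<lambda>u. (B + 1) * F u s) \<longlongrightarrow> 0) (at_right s)" by simp
  have "((\<lambda>u. kernel_path F x u - kernel_path F x s) \<longlongrightarrow> 0) (at_right s)"
  proof (rule Lim_null_comparison[OF _ lim])
    show "\<forall>\<^sub>F u in at_right s. norm (kernel_path F x u - kernel_path F x s) \<le> (B + 1) * F u s"
      unfolding eventually_at_right_field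
    proof (intro exI[of _ "min (s + h) 1"] conjI allI impI)
      show "s < min (s + h) 1" using h(1) s by simp
      fix u assume "s < u" "u < min (s + h) 1"
      then show "norm (kernel_path F x u - kernel_path F x s) \<le> (B + 1) * F u s"
        using h(2)[of s u] s by simp
    qed
  qed
  then show ?thesis by (rule LIM_zero_cancel)
qed

end

section \<open>The stochastic integral of a deterministic function\<close>

text \<open>If \<open>Y\<close> and \<open>Z\<close> were further apart than \<open>e\<close>, then all late \<open>S n\<close> would be further than \<open>e\<close>
  from \<open>Y\<close>, and such an event is contained in events of arbitrarily small measure.\<close>

lemma limit_in_probability_eq_pointwise_limit:
  fixes S :: "nat \<Rightarrow> 'a \<Rightarrow> real"
  assumes [measurable]: "\<And>n. S n \<in> borel_measurable M" "Y \<in> borel_measurable M"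
    and prob: "\<And>e. 0 < e \<Longrightarrow> (\<lambda>n. emeasure M {\<omega>\<in>space M. e < \<bar>S n \<omega> - Y \<omega>\<bar>}) \<longlonglongrightarrow> 0"
    and lim: "AE \<omega> in M. (\<lambda>n. S n \<omega>) \<longlonglongrightarrow> Z \<omega>"
  shows "AE \<omega> in M. Y \<omega> = Z \<omega>"
proof -
  have *: "AE \<omega> in M. \<not> (\<forall>n\<ge>m. e < \<bar>S n \<omega> - Y \<omega>\<bar>)" if "0 < e" for m :: nat and e :: real
  proof -
    let ?A = "{\<omega>\<in>space M. \<forall>n\<ge>m. e < \<bar>S n \<omega> - Y \<omega>\<bar>}"
    have [measurable]: "?A \<in> sets M" by measurable
    have "emeasure M ?A \<le> 0"
    proof (rule tendsto_lowerbound[OF prob[OF that]])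
      show "\<forall>\<^sub>F n in sequentially. emeasure M ?A \<le> emeasure M {\<omega>\<in>space M. e < \<bar>S n \<omega> - Y \<omega>\<bar>}"
        using eventually_ge_at_top[of m] by eventually_elim (intro emeasure_mono; auto)
    qed simp
    then show ?thesis by (subst AE_iff_measurable[of ?A]) auto
  qed
  have "AE \<omega> in M. \<forall>k m. \<not> (\<forall>n\<ge>m. 1 / real (Suc k) < \<bar>S n \<omega> - Y \<omega>\<bar>)"
    unfolding AE_all_countable by (intro allI *) simp
  with lim show ?thesis
  proof eventually_elim
    fix \<omega> assume l: "(\<lambda>n. S n \<omega>) \<longlonglongrightarrow> Z \<omega>"
      and far: "\<forall>k m. \<not> (\<forall>n\<ge>m. 1 / real (Suc k) < \<bar>S n \<omega> - Y \<omega>\<bar>)"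
    show "Y \<omega> = Z \<omega>"
    proof (rule ccontr)
      assume "Y \<omega> \<noteq> Z \<omega>"
      then have "0 < \<bar>Z \<omega> - Y \<omega>\<bar>" by simp
      then obtain k where k: "1 / real (Suc k) < \<bar>Z \<omega> - Y \<omega>\<bar>"
        using nat_approx_posE by blast
      have "(\<lambda>n. \<bar>S n \<omega> - Y \<omega>\<bar>) \<longlonglongrightarrow> \<bar>Z \<omega> - Y \<omega>\<bar>" by (intro tendsto_intros l)
      then have "\<forall>\<^sub>F n in sequentially. 1 / real (Suc k) < \<bar>S n \<omega> - Y \<omega>\<bar>"
        using k by (rule order_tendstoD)
      then show False using far unfolding eventually_sequentially by blast
    qed
  qed
qed

lemma summation_by_parts:
  fixes a b :: "nat \<Rightarrow> real"
  shows "(\<Sum>i<m. a i * (b (Suc i) - b i))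
    = a m * b m - a 0 * b 0 - (\<Sum>i<m. b (Suc i) * (a (Suc i) - a i))"
  by (induction m) (auto simp: algebra_simps)

text \<open>Deterministic equidistant partitions are admissible in the definition of the integral. By
  uniform continuity the resulting step functions converge uniformly to \<open>G\<close>, hence the
  elementary integrals converge in probability to \<open>Y t\<close>. Summed by parts, these integrals are
  sums of increments of \<open>G\<close> against \<open>X\<close>, and they converge for each path.\<close>

lemma stochastic_integral_by_parts:
  assumes filt: "filtration (space P) \<F>" and sub: "\<And>t. subalgebra P (\<F> t)"
    and X: "adapted \<F> X" "AE \<omega> in P. cadlag (\<lambda>t. X t \<omega>)" "AE \<omega> in P. X 0 \<omega> = 0"
    and t: "0 < t" and G: "continuous_on {0..t} G" "G t = 0"
    and g: "\<And>r. 0 < r \<Longrightarrow> r < t \<Longrightarrow> (G has_real_derivative g r) (at r)"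
    and abs_g: "(\<lambda>r. \<bar>g r\<bar>) integrable_on {0..t}"
    and Y: "has_stochastic_integral P \<F> X (\<lambda>r \<omega>. G r * indicator {0..t} r) Y"
  shows "AE \<omega> in P. Y t \<omega> = - integral {0..t} (\<lambda>r. X r \<omega> * g r)"
proof -
  interpret filtration "space P" \<F> by (rule filt)
  define \<tau> where "\<tau> n i = t * real i / real (Suc n)" for n i
  define T where "T n i \<omega> = \<tau> n i" for n i and \<omega> :: 'a
  define \<eta> where "\<eta> n \<omega> = G 0" for n :: nat and \<omega> :: 'a
  define \<xi> where "\<xi> n i \<omega> = G (\<tau> n i)" for n i and \<omega> :: 'a
  have \<tau>0: "\<tau> n 0 = 0" and \<tau>t: "\<tau> n (Suc n) = t" for n by (auto simp: \<tau>_def)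
  have \<tau>_mono: "\<tau> n i \<le> \<tau> n j" if "i \<le> j" for n i j
    using t that by (auto simp: \<tau>_def intro!: divide_right_mono mult_left_mono)
  have \<tau>_ge: "0 \<le> \<tau> n i" for n i using t by (simp add: \<tau>_def)
  have \<tau>_le: "\<tau> n i \<le> t" if "i \<le> Suc n" for n i using \<tau>_mono[OF that, of n] \<tau>t[of n] by simp
  have \<tau>_Suc: "\<tau> n (Suc i) = \<tau> n i + t / real (Suc n)" for n i
    by (simp add: \<tau>_def distrib_left add_divide_distrib)
  have "simple_data P \<F> (Suc n) (T n) (\<eta> n) (\<xi> n)" for n
    unfolding simple_data_def T_def \<eta>_def \<xi>_def
    using \<tau>0 \<tau>_mono by (auto intro: stopping_time_const)
  moreover have "ucp P (\<lambda>n. simple_process (Suc n) (T n) (\<eta> n) (\<xi> n)) (\<lambda>r \<omega>. G r * indicator {0..t} r)"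
    unfolding ucp_def
  proof (intro allI impI)
    fix t' e :: real assume "0 \<le> t'" and e: "0 < e"
    have "uniformly_continuous_on {0..t} G"
      using G(1) by (rule compact_uniformly_continuous) simp
    then obtain \<gamma> where \<gamma>: "0 < \<gamma>" "\<And>r r'. r \<in> {0..t} \<Longrightarrow> r' \<in> {0..t} \<Longrightarrow> \<bar>r' - r\<bar> < \<gamma> \<Longrightarrow> \<bar>G r' - G r\<bar> < e"
      using e unfolding uniformly_continuous_on_def dist_real_def by metis
    obtain N where "t / \<gamma> < real N" using reals_Archimedean2 by blast
    then have N: "t / real (Suc N) < \<gamma>" using t \<gamma>(1) by (simp add: field_simps)
    have close: "\<bar>simple_process (Suc n) (T n) (\<eta> n) (\<xi> n) s \<omega> - G s * indicator {0..t} s\<bar> \<le> e"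
      if n: "N \<le> n" and s: "0 \<le> s" for n s \<omega>
    proof (cases "0 < s \<and> s \<le> t")
      case False
      have "indicator {\<tau> n i<..\<tau> n (Suc i)} s = (0::real)" if "i < Suc n" for i
        using False s \<tau>_ge[of n i] \<tau>_le[of "Suc i" n] that by (auto simp: indicator_def)
      then have "(\<Sum>i<Suc n. \<xi> n i \<omega> * indicator {T n i \<omega><..T n (Suc i) \<omega>} s) = 0"
        unfolding T_def by (intro sum.neutral) simp
      then have "simple_process (Suc n) (T n) (\<eta> n) (\<xi> n) s \<omega> = G 0 * indicator {0} s"
        unfolding simple_process_def \<eta>_def by simp
      also have "\<dots> = G s * indicator {0..t} s"
        using False s t by (cases "s = 0") auto
      finally show ?thesis using e by simp
    next
      case True
      define z where "z = \<lceil>s * real (Suc n) / t\<rceil>"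
      have "0 < z" using True t by (simp add: z_def)
      have "z \<le> int (Suc n)"
        unfolding z_def using True t by (simp add: ceiling_le_iff field_simps del: of_nat_Suc)
      define i where "i = nat (z - 1)"
      have i: "i < Suc n" "z = int i + 1" using \<open>0 < z\<close> \<open>z \<le> int (Suc n)\<close> by (auto simp: i_def)
      have ind: "indicator {\<tau> n j<..\<tau> n (Suc j)} s = (if j = i then 1 else (0::real))" for j
      proof -
        have "\<tau> n j < s \<and> s \<le> \<tau> n (Suc j) \<longleftrightarrow> real j < s * real (Suc n) / t \<and> s * real (Suc n) / t \<le> real j + 1"
          using t by (simp add: \<tau>_def field_simps)
        also have "\<dots> \<longleftrightarrow> z = int j + 1"
          unfolding z_def ceiling_eq_iff by auto
        finally show ?thesis using i(2) by (auto simp: indicator_def)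
      qed
      have "simple_process (Suc n) (T n) (\<eta> n) (\<xi> n) s \<omega>
          = (\<Sum>j<Suc n. G (\<tau> n j) * (if j = i then 1 else 0))"
        unfolding simple_process_def T_def \<xi>_def ind using True by simp
      also have "\<dots> = (\<Sum>j<Suc n. if j = i then G (\<tau> n j) else 0)"
        by (intro sum.cong) auto
      also have "\<dots> = G (\<tau> n i)" using i(1) by (subst sum.delta) auto
      finally have sp: "simple_process (Suc n) (T n) (\<eta> n) (\<xi> n) s \<omega> = G (\<tau> n i)" .
      have "\<tau> n i < s" "s \<le> \<tau> n (Suc i)"
        using ind[of i] by (auto simp: indicator_def split: if_splits)
      moreover have "t / real (Suc n) \<le> t / real (Suc N)" using n t by (intro divide_left_mono) auto
      ultimately have "\<bar>G (\<tau> n i) - G s\<bar> < e"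
        using True N \<tau>_Suc[of n i] \<tau>_ge[of n i] by (intro \<gamma>(2)) auto
      then show ?thesis using sp True by simp
    qed
    have "\<forall>\<^sub>F n in sequentially. outer_measure_of P {\<omega>\<in>space P. \<exists>s\<in>{0..t'}.
        e < \<bar>simple_process (Suc n) (T n) (\<eta> n) (\<xi> n) s \<omega> - G s * indicator {0..t} s\<bar>} = 0"
      using eventually_ge_at_top[of N]
    proof eventually_elim
      fix n assume "N \<le> n"
      then have "{\<omega>\<in>space P. \<exists>s\<in>{0..t'}. e < \<bar>simple_process (Suc n) (T n) (\<eta> n) (\<xi> n) s \<omega>
          - G s * indicator {0..t} s\<bar>} = {}"
        using close by (force simp: not_less)
      then show "outer_measure_of P {\<omega>\<in>space P. \<exists>s\<in>{0..t'}. e < \<bar>simple_process (Suc n) (T n) (\<eta> n) (\<xi> n) s \<omega>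
          - G s * indicator {0..t} s\<bar>} = 0"
        by (simp only: outer_measure_of_eq[OF sets.empty_sets] emeasure_empty)
    qed
    then show "(\<lambda>n. outer_measure_of P {\<omega>\<in>space P. \<exists>s\<in>{0..t'}.
        e < \<bar>simple_process (Suc n) (T n) (\<eta> n) (\<xi> n) s \<omega> - G s * indicator {0..t} s\<bar>}) \<longlonglongrightarrow> 0"
      by (rule tendsto_eventually)
  qed
  ultimately have ucp: "ucp P (\<lambda>n. simple_integral X (Suc n) (T n) (\<eta> n) (\<xi> n)) Y"
    using Y unfolding has_stochastic_integral_def by blast
  define S where "S n = simple_integral X (Suc n) (T n) (\<eta> n) (\<xi> n) t" for n
  have meas: "Z \<in> borel_measurable P" if "Z \<in> borel_measurable (\<F> s)" for Z :: "'a \<Rightarrow> real" and s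
    using measurable_from_subalg[OF sub that] .
  have X_meas: "X s \<in> borel_measurable P" if "0 \<le> s" for s
    using X(1) that by (auto simp: adapted_def intro: meas)
  have Y_meas: "Y t \<in> borel_measurable P"
    using Y t by (intro meas[of _ t]) (auto simp: has_stochastic_integral_def adapted_def)
  have S_eq: "S n \<omega> = G 0 * X 0 \<omega> + (\<Sum>i<Suc n. G (\<tau> n i) * (X (\<tau> n (Suc i)) \<omega> - X (\<tau> n i) \<omega>))" for n \<omega>
    unfolding S_def simple_integral_def T_def \<eta>_def \<xi>_def
    by (intro arg_cong2[of _ _ _ _ "(+)"] sum.cong refl) (simp add: min_absorb2 \<tau>_le)
  have S_meas: "S n \<in> borel_measurable P" for n
    unfolding S_eq[abs_def]
    by (intro borel_measurable_add borel_measurable_times borel_measurable_sum borel_measurable_diff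
        borel_measurable_const X_meas \<tau>_ge order_refl)
  have prob: "(\<lambda>n. emeasure P {\<omega>\<in>space P. e < \<bar>S n \<omega> - Y t \<omega>\<bar>}) \<longlonglongrightarrow> 0" if e: "0 < e" for e
  proof (rule tendsto_sandwich[OF _ _ tendsto_const])
    let ?B = "\<lambda>n. {\<omega>\<in>space P. \<exists>s\<in>{0..t}. e < \<bar>simple_integral X (Suc n) (T n) (\<eta> n) (\<xi> n) s \<omega> - Y s \<omega>\<bar>}"
    show "(\<lambda>n. outer_measure_of P (?B n)) \<longlonglongrightarrow> 0"
      using ucp e t by (simp add: ucp_def)
    have "emeasure P {\<omega>\<in>space P. e < \<bar>S n \<omega> - Y t \<omega>\<bar>} \<le> outer_measure_of P (?B n)" for n
    proof -
      have "{\<omega>\<in>space P. e < \<bar>S n \<omega> - Y t \<omega>\<bar>} \<in> sets P" using S_meas Y_meas by measurable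
      then have "emeasure P {\<omega>\<in>space P. e < \<bar>S n \<omega> - Y t \<omega>\<bar>}
          = outer_measure_of P {\<omega>\<in>space P. e < \<bar>S n \<omega> - Y t \<omega>\<bar>}"
        by (simp add: outer_measure_of_eq)
      also have "\<dots> \<le> outer_measure_of P (?B n)"
      proof (rule outer_measure_of_mono, rule subsetI)
        fix \<omega> assume "\<omega> \<in> {\<omega>\<in>space P. e < \<bar>S n \<omega> - Y t \<omega>\<bar>}"
        moreover have "t \<in> {0..t}" using t by simp
        ultimately show "\<omega> \<in> ?B n" unfolding S_def by blast
      qed
      finally show ?thesis .
    qed
    then show "\<forall>\<^sub>F n in sequentially. emeasure P {\<omega>\<in>space P. e < \<bar>S n \<omega> - Y t \<omega>\<bar>} \<le> outer_measure_of P (?B n)"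
      by simp
  qed simp
  have "AE \<omega> in P. (\<lambda>n. S n \<omega>) \<longlonglongrightarrow> - integral {0..t} (\<lambda>r. X r \<omega> * g r)"
    using X(2,3)
  proof eventually_elim
    fix \<omega> assume c: "cadlag (\<lambda>t. X t \<omega>)" and z: "X 0 \<omega> = 0"
    have S_sum: "S n \<omega> = - (\<Sum>i<Suc n. X (\<tau> n (Suc i)) \<omega> * (G (\<tau> n (Suc i)) - G (\<tau> n i)))" for n
      unfolding S_eq summation_by_parts[of "\<lambda>i. G (\<tau> n i)" "\<lambda>i. X (\<tau> n i) \<omega>"]
      by (simp add: \<tau>0 \<tau>t z G(2))
    show "(\<lambda>n. S n \<omega>) \<longlonglongrightarrow> - integral {0..t} (\<lambda>r. X r \<omega> * g r)"
      unfolding S_sum \<tau>_def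
      by (rule tendsto_minus[OF stieltjes_sums_tendsto(2)[OF t c G(1) g abs_g]])
  qed
  then show ?thesis
    by (intro limit_in_probability_eq_pointwise_limit[where S = S and Y = "Y t"] S_meas Y_meas prob)
qed

section \<open>The modulus of continuity of the integral process\<close>

theorem theorem1p5:
  fixes P :: "'a measure"
    and \<F> :: "real \<Rightarrow> 'a measure"
    and F :: "real \<Rightarrow> real \<Rightarrow> real"
    and X M :: "real \<Rightarrow> 'a \<Rightarrow> real"
    and d :: real
  assumes "prob_space P"
    and "filtration (space P) \<F>"
    and "\<And>t. subalgebra P (\<F> t)"
    and "0 < d" and "d < 1"
    and "smooth_variation d F"
    and "semimartingale P \<F> X"
    and "AE \<omega> in P. X 0 \<omega> = 0"
    and "\<And>t. 0 \<le> t \<Longrightarrow> is_kernel_integral P \<F> F X t (M t)"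
    and "AE \<omega> in P. \<forall>t\<ge>0. ((\<lambda>u. M u \<omega>) \<longlongrightarrow> M t \<omega>) (at_right t)"
  shows "AE \<omega> in P.
      (normalized_modulus F (\<lambda>t. M t \<omega>) \<longlongrightarrow>
         (SUP s\<in>{0..<1}. ennreal \<bar>jump (\<lambda>t. X t \<omega>) s\<bar>)) (at_right 0) \<and>
      (jump (\<lambda>t. X t \<omega>) 1 = 0 \<longrightarrow>
         (normalized_modulus F (\<lambda>t. M t \<omega>) \<longlongrightarrow>
           (SUP s\<in>{0..1}. ennreal \<bar>jump (\<lambda>t. X t \<omega>) s\<bar>)) (at_right 0))"
proof -
  obtain \<delta> c q where "diagonal_kernel F \<delta> c q"
    using smooth_variation_imp_diagonal_kernel assms(4-6) by blast
  then interpret diagonal_kernel F \<delta> c q .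
  have X: "adapted \<F> X" "AE \<omega> in P. cadlag (\<lambda>t. X t \<omega>)"
    using assms(7) by (auto simp: semimartingale_def)
  have parts: "AE \<omega> in P. M t \<omega> = kernel_path F (\<lambda>r. X r \<omega>) t" if t: "0 < t" "t < 1" for t
  proof -
    obtain Y where Y: "has_stochastic_integral P \<F> X (\<lambda>r \<omega>. F t r * indicator {0..t} r) Y"
      and MY: "AE \<omega> in P. M t \<omega> = Y t \<omega>"
      using assms(9)[of t] t by (auto simp: is_kernel_integral_def)
    have "AE \<omega> in P. Y t \<omega> = - integral {0..t} (\<lambda>r. X r \<omega> * d_snd F t r)"
      using t by (intro stochastic_integral_by_parts[OF assms(2,3) X assms(8) _ _ _ _ _ Y]
          continuous_on_kernel_section[OF cont] diag deriv_snd abs_d_snd_integrable) auto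
    with MY show ?thesis by eventually_elim (simp add: kernel_path_def)
  qed
  have "AE \<omega> in P. \<forall>a. 0 < real_of_rat a \<and> real_of_rat a < 1 \<longrightarrow>
      M (of_rat a) \<omega> = kernel_path F (\<lambda>r. X r \<omega>) (of_rat a)"
    unfolding AE_all_countable
  proof
    fix a :: rat
    show "AE \<omega> in P. 0 < real_of_rat a \<and> real_of_rat a < 1 \<longrightarrow>
        M (of_rat a) \<omega> = kernel_path F (\<lambda>r. X r \<omega>) (of_rat a)"
      using parts[of "of_rat a"] by (cases "0 < real_of_rat a \<and> real_of_rat a < 1") (auto simp del: of_rat_less_1_iff zero_less_of_rat_iff)
  qed
  with X(2) assms(8,10) show ?thesis
  proof eventually_elim
    fix \<omega>
    assume x: "cadlag (\<lambda>t. X t \<omega>)" "X 0 \<omega> = 0"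
      and M: "\<forall>t\<ge>0. ((\<lambda>u. M u \<omega>) \<longlongrightarrow> M t \<omega>) (at_right t)"
      and rat: "\<forall>a. 0 < real_of_rat a \<and> real_of_rat a < 1 \<longrightarrow>
        M (of_rat a) \<omega> = kernel_path F (\<lambda>r. X r \<omega>) (of_rat a)"
    let ?z = "kernel_path F (\<lambda>r. X r \<omega>)"
    \<comment> \<open>The difference is right continuous and vanishes at the rational times.\<close>
    have eq: "M t \<omega> = ?z t" if t: "0 < t" "t < 1" for t
    proof (rule ccontr)
      assume "M t \<omega> \<noteq> ?z t"
      moreover have "((\<lambda>u. M u \<omega> - ?z u) \<longlongrightarrow> M t \<omega> - ?z t) (at_right t)"
        using M t kernel_path_right_continuous[OF x t] by (intro tendsto_diff) auto
      ultimately have "\<forall>\<^sub>F u in at_right t. M u \<omega> - ?z u \<noteq> 0"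
        by (intro tendsto_imp_eventually_ne) auto
      then obtain b where b: "t < b" "\<And>u. t < u \<Longrightarrow> u < b \<Longrightarrow> M u \<omega> \<noteq> ?z u"
        unfolding eventually_at_right_field by auto
      obtain a :: rat where "t < of_rat a" "of_rat a < min b 1"
        using of_rat_dense[of t "min b 1"] b(1) t by auto
      moreover from this have "0 < real_of_rat a" using t by linarith
      ultimately show False using b(2)[of "of_rat a"] rat by (auto simp del: of_rat_less_1_iff zero_less_of_rat_iff)
    qed
    have "normalized_modulus F (\<lambda>t. M t \<omega>) = normalized_modulus F ?z"
      unfolding normalized_modulus_def
    proof (rule ext, rule SUP_cong[OF refl], clarify)
      fix s t :: real assume "0 < s" "s < t" "t < 1"
      then show "ennreal (\<bar>M t \<omega> - M s \<omega>\<bar> / F t s) = ennreal (\<bar>?z t - ?z s\<bar> / F t s)"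
        using eq[of s] eq[of t] by simp
    qed
    then have lim: "(normalized_modulus F (\<lambda>t. M t \<omega>) \<longlongrightarrow>
         (SUP s\<in>{0..<1}. ennreal \<bar>jump (\<lambda>t. X t \<omega>) s\<bar>)) (at_right 0)"
      using kernel_path_modulus_tendsto[OF x] by simp
    have "(SUP s\<in>{0..1}. ennreal \<bar>jump (\<lambda>t. X t \<omega>) s\<bar>) = (SUP s\<in>{0..<1}. ennreal \<bar>jump (\<lambda>t. X t \<omega>) s\<bar>)"
      if "jump (\<lambda>t. X t \<omega>) 1 = 0"
    proof -
      have "{0..1::real} = insert 1 {0..<1}" by auto
      then show ?thesis using that by (simp add: sup_absorb2)
    qed
    with lim show "(normalized_modulus F (\<lambda>t. M t \<omega>) \<longlongrightarrow>
         (SUP s\<in>{0..<1}. ennreal \<bar>jump (\<lambda>t. X t \<omega>) s\<bar>)) (at_right 0) \<and>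
      (jump (\<lambda>t. X t \<omega>) 1 = 0 \<longrightarrow>
         (normalized_modulus F (\<lambda>t. M t \<omega>) \<longlongrightarrow>
           (SUP s\<in>{0..1}. ennreal \<bar>jump (\<lambda>t. X t \<omega>) s\<bar>)) (at_right 0))"
      by simp
  qed
qed

end
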